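(* Let $(M,\omega)$ be a compact connected symplectic manifold. The Hamiltonian vector fields, with respect to $\widetilde\omega$, of the functions in $\Omega^0\mathcal{P}M$ are completely determined by the Hamiltonian vector fields, with respect to $\omega$, of the functions in $C^\infty(M)$. More precisely, let $f,g\in C^\infty(M)$, let $\widetilde f(\gamma)=\int_0^1 f(\gamma(t))\,dt$ and $\widetilde g(\gamma)=\int_0^1 g(\gamma(t))\,dt$ be the induced functions on $\mathcal{P}M$, and let $\zeta:=\widetilde f\,\widetilde g\in\Omega^0\mathcal{P}M$. Then the Hamiltonian vector field $\widetilde X_\zeta$ on $\mathcal{P}M$ corresponding to $\zeta$ is given, for $\gamma\in\mathcal{P}M$ and $t\in[0,1]$, by $$\bigl(\widetilde X_\zeta(\gamma)\bigr)(t)=\Bigl(\int_0^1 g(\gamma(s))\,ds\Bigr)X_f(\gamma(t))+\Bigl(\int_0^1 f(\gamma(s))\,ds\Bigr)X_g(\gamma(t)).$$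
   Context: $\mathcal{P}M$ is the space of all smooth maps $\gamma:[0,1]\to M$, with its standard (Chen) differentiable structure; the tangent space at $\gamma$ is the space of smooth vector fields along $\gamma$. With $\mathrm{ev}_t(\gamma)=\gamma(t)$, one has $d\,\mathrm{ev}_t(v(\gamma))=(v(\gamma))(t)$. The weakly symplectic form on $\mathcal{P}M$ is $$\bigl(\widetilde\omega(v_1,v_2)\bigr)(\gamma)=\int_0^1\omega\bigl(d\,\mathrm{ev}_t(v_1(\gamma)),d\,\mathrm{ev}_t(v_2(\gamma))\bigr)\,dt.$$ $\Omega^0\mathcal{P}M$ denotes the space of functions on $\mathcal{P}M$ that can be written as finite sums $\sum_i c_i(\widetilde{f_i})^{n_i}$ with $c_i\in\mathbb{R}$, $f_i\in C^\infty(M)$, $n_i$ nonnegative integers, where $\widetilde{f_i}(\gamma)=\int_0^1 f_i(\gamma(t))\,dt$. On $M$, $X_f$ is defined by $i_{X_f}\omega=-df$. On $\mathcal{P}M$, the Hamiltonian vector field $\widetilde X_\phi$ of a function $\phi$ is the (unique, if it exists) vector field with $i_{\widetilde X_\phi}\widetilde\omega=-\mathrm{d}\phi$. The differential of $\widetilde f$ is $(\mathrm{d}\widetilde f(v))(\gamma)=\int_0^1 df(d\,\mathrm{ev}_t(v(\gamma)))\,dt$, extended to $\Omega^0\mathcal{P}M$ by the Leibniz rule. *)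

theory Defs
  imports "HOL-Analysis.Analysis"
begin

section \<open>Smooth maps between subsets of Euclidean spaces\<close>

text \<open>On an open set, C^k is defined by iterated directional derivatives; in finite dimension this
  is the usual notion. On an arbitrary subset (such as \<open>[0,1]\<close>), a map is smooth if it extends
  locally to a smooth map on an open set, which covers smoothness up to the boundary.\<close>

fun Ck_on_open :: "nat \<Rightarrow> 'b::euclidean_space set \<Rightarrow> ('b \<Rightarrow> 'c::real_normed_vector) \<Rightarrow> bool" where
  "Ck_on_open 0 S h \<longleftrightarrow> continuous_on S h"
| "Ck_on_open (Suc k) S h \<longleftrightarrow>
     (\<forall>x\<in>S. h differentiable (at x)) \<and> (\<forall>u. Ck_on_open k S (\<lambda>x. frechet_derivative h (at x) u))"

definition smooth_on :: "'b::euclidean_space set \<Rightarrow> ('b \<Rightarrow> 'c::real_normed_vector) \<Rightarrow> bool" where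
  "smooth_on S h \<longleftrightarrow>
     (\<forall>x\<in>S. \<exists>N H. open N \<and> x \<in> N \<and> (\<forall>k. Ck_on_open k N H) \<and> (\<forall>y\<in>N \<inter> S. H y = h y))"


section \<open>Smooth manifolds\<close>

text \<open>The manifold is the whole type \<open>'a\<close>. A chart is a pair of its domain and a coordinate map whose
  values outside the domain are irrelevant.\<close>

type_synonym ('a, 'e) chart = "'a set \<times> ('a \<Rightarrow> 'e)"

abbreviation chart_dom :: "('a, 'e) chart \<Rightarrow> 'a set" where
  "chart_dom c \<equiv> fst c"

abbreviation chart_map :: "('a, 'e) chart \<Rightarrow> 'a \<Rightarrow> 'e" where
  "chart_map c \<equiv> snd c"

definition chart_img :: "('a, 'e) chart \<Rightarrow> 'e set" where
  "chart_img c = chart_map c ` chart_dom c"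

definition chart_inv :: "('a, 'e) chart \<Rightarrow> 'e \<Rightarrow> 'a" where
  "chart_inv c = inv_into (chart_dom c) (chart_map c)"

definition smooth_atlas ::
  "('a::{t2_space,second_countable_topology}, 'e::euclidean_space) chart set \<Rightarrow> bool" where
  "smooth_atlas A \<longleftrightarrow>
     (\<Union>c\<in>A. chart_dom c) = UNIV \<and>
     (\<forall>c\<in>A. open (chart_dom c) \<and> open (chart_img c) \<and>
        homeomorphism (chart_dom c) (chart_img c) (chart_map c) (chart_inv c)) \<and>
     (\<forall>c\<in>A. \<forall>c'\<in>A. smooth_on (chart_map c ` (chart_dom c \<inter> chart_dom c'))
                                 (chart_map c' \<circ> chart_inv c))"

definition C_inf :: "('a, 'e::euclidean_space) chart set \<Rightarrow> ('a \<Rightarrow> real) set" where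
  "C_inf A = {f. \<forall>c\<in>A. smooth_on (chart_img c) (f \<circ> chart_inv c)}"

definition smooth_into ::
  "('a::topological_space, 'e::euclidean_space) chart set \<Rightarrow> 'b::euclidean_space set \<Rightarrow> ('b \<Rightarrow> 'a) \<Rightarrow> bool" where
  "smooth_into A S h \<longleftrightarrow>
     continuous_on S h \<and> (\<forall>c\<in>A. smooth_on {x\<in>S. h x \<in> chart_dom c} (chart_map c \<circ> h))"


section \<open>Tangent vectors\<close>

text \<open>A tangent vector at \<open>p\<close> is represented by its components in all charts around \<open>p\<close>, which
  transform by the derivatives of the transition maps; the value at a chart not containing \<open>p\<close> is
  set to 0, so that equality and the vector space operations are those of functions.\<close>

type_synonym ('a, 'e) tvec = "('a, 'e) chart \<Rightarrow> 'e"

definition transition_deriv ::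
  "('a, 'e::euclidean_space) chart \<Rightarrow> ('a, 'e) chart \<Rightarrow> 'a \<Rightarrow> 'e \<Rightarrow> 'e" where
  "transition_deriv c c' p = frechet_derivative (chart_map c' \<circ> chart_inv c) (at (chart_map c p))"

definition tangent_space ::
  "('a, 'e::euclidean_space) chart set \<Rightarrow> 'a \<Rightarrow> ('a, 'e) tvec set" where
  "tangent_space A p =
     {v. (\<forall>c. c \<in> A \<and> p \<in> chart_dom c \<or> v c = 0) \<and>
         (\<forall>c\<in>A. \<forall>c'\<in>A. p \<in> chart_dom c \<and> p \<in> chart_dom c' \<longrightarrow> v c' = transition_deriv c c' p (v c))}"

definition tadd :: "('a, 'e::euclidean_space) tvec \<Rightarrow> ('a, 'e) tvec \<Rightarrow> ('a, 'e) tvec" where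
  "tadd v w = (\<lambda>c. v c + w c)"

definition tscale :: "real \<Rightarrow> ('a, 'e::euclidean_space) tvec \<Rightarrow> ('a, 'e) tvec" where
  "tscale r v = (\<lambda>c. r *\<^sub>R v c)"

definition tsum :: "('i \<Rightarrow> ('a, 'e::euclidean_space) tvec) \<Rightarrow> 'i set \<Rightarrow> ('a, 'e) tvec" where
  "tsum V I = (\<lambda>c. \<Sum>i\<in>I. V i c)"

text \<open>The tangent vector at \<open>p\<close> with component \<open>u\<close> in the chart \<open>c\<close>.\<close>

definition coord_vec ::
  "('a, 'e::euclidean_space) chart set \<Rightarrow> ('a, 'e) chart \<Rightarrow> 'a \<Rightarrow> 'e \<Rightarrow> ('a, 'e) tvec" where
  "coord_vec A c p u =
     (\<lambda>c'. if c' \<in> A \<and> p \<in> chart_dom c' then transition_deriv c c' p u else 0)"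

text \<open>The differential of a smooth function, computed in an arbitrary chart around \<open>p\<close> (by the
  chain rule, the value does not depend on it).\<close>

definition differential ::
  "('a, 'e::euclidean_space) chart set \<Rightarrow> ('a \<Rightarrow> real) \<Rightarrow> 'a \<Rightarrow> ('a, 'e) tvec \<Rightarrow> real" where
  "differential A f p v =
     (let c = (SOME c. c \<in> A \<and> p \<in> chart_dom c)
      in frechet_derivative (f \<circ> chart_inv c) (at (chart_map c p)) (v c))"

text \<open>Smoothness of a family \<open>V x \<in> T\<^bsub>h x\<^esub>M\<close> of tangent vectors along a map \<open>h\<close>.\<close>

definition smooth_along ::
  "('a, 'e::euclidean_space) chart set \<Rightarrow> 'b::euclidean_space set \<Rightarrow> ('b \<Rightarrow> 'a) \<Rightarrow>
     ('b \<Rightarrow> ('a, 'e) tvec) \<Rightarrow> bool" where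
  "smooth_along A S h V \<longleftrightarrow> (\<forall>c\<in>A. smooth_on {x\<in>S. h x \<in> chart_dom c} (\<lambda>x. V x c))"

definition vector_fields ::
  "('a, 'e::euclidean_space) chart set \<Rightarrow> ('a \<Rightarrow> ('a, 'e) tvec) set" where
  "vector_fields A =
     {X. (\<forall>p. X p \<in> tangent_space A p) \<and>
         (\<forall>c\<in>A. smooth_on (chart_img c) (\<lambda>x. X (chart_inv c x) c))}"


section \<open>Symplectic forms and Hamiltonian vector fields\<close>

type_synonym ('a, 'e) form2 = "'a \<Rightarrow> ('a, 'e) tvec \<Rightarrow> ('a, 'e) tvec \<Rightarrow> real"

text \<open>The coefficients of a 2-form in a chart, with respect to constant vector fields.\<close>

definition form2_coeff ::
  "('a, 'e::euclidean_space) chart set \<Rightarrow> ('a, 'e) form2 \<Rightarrow> ('a, 'e) chart \<Rightarrow> 'e \<Rightarrow> 'e \<Rightarrow> 'e \<Rightarrow> real" where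
  "form2_coeff A \<omega> c u v x =
     \<omega> (chart_inv c x) (coord_vec A c (chart_inv c x) u) (coord_vec A c (chart_inv c x) v)"

definition two_form :: "('a, 'e::euclidean_space) chart set \<Rightarrow> ('a, 'e) form2 \<Rightarrow> bool" where
  "two_form A \<omega> \<longleftrightarrow>
     (\<forall>p. \<forall>v\<in>tangent_space A p. \<forall>w\<in>tangent_space A p.
        \<omega> p v w = - \<omega> p w v \<and>
        (\<forall>r. \<omega> p (tscale r v) w = r * \<omega> p v w) \<and>
        (\<forall>v'\<in>tangent_space A p. \<omega> p (tadd v v') w = \<omega> p v w + \<omega> p v' w)) \<and>
     (\<forall>c\<in>A. \<forall>u v. smooth_on (chart_img c) (form2_coeff A \<omega> c u v))"

text \<open>The coordinate formula for \<open>d\<omega>\<close> on constant vector fields, whose Lie brackets vanish.\<close>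

definition closed_form2 :: "('a, 'e::euclidean_space) chart set \<Rightarrow> ('a, 'e) form2 \<Rightarrow> bool" where
  "closed_form2 A \<omega> \<longleftrightarrow>
     (\<forall>c\<in>A. \<forall>x\<in>chart_img c. \<forall>u v w.
        frechet_derivative (form2_coeff A \<omega> c v w) (at x) u +
        frechet_derivative (form2_coeff A \<omega> c w u) (at x) v +
        frechet_derivative (form2_coeff A \<omega> c u v) (at x) w = 0)"

definition nondegenerate_form2 :: "('a, 'e::euclidean_space) chart set \<Rightarrow> ('a, 'e) form2 \<Rightarrow> bool" where
  "nondegenerate_form2 A \<omega> \<longleftrightarrow>
     (\<forall>p. \<forall>v\<in>tangent_space A p. (\<forall>w\<in>tangent_space A p. \<omega> p v w = 0) \<longrightarrow> v = (\<lambda>c. 0))"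

definition symplectic_manifold ::
  "('a::{t2_space,second_countable_topology}, 'e::euclidean_space) chart set \<Rightarrow>
     ('a, 'e) form2 \<Rightarrow> bool" where
  "symplectic_manifold A \<omega> \<longleftrightarrow>
     smooth_atlas A \<and> two_form A \<omega> \<and> closed_form2 A \<omega> \<and> nondegenerate_form2 A \<omega>"

definition is_hamiltonian_vf ::
  "('a, 'e::euclidean_space) chart set \<Rightarrow> ('a, 'e) form2 \<Rightarrow> ('a \<Rightarrow> real) \<Rightarrow>
     ('a \<Rightarrow> ('a, 'e) tvec) \<Rightarrow> bool" where
  "is_hamiltonian_vf A \<omega> f X \<longleftrightarrow>
     X \<in> vector_fields A \<and> (\<forall>p. \<forall>w\<in>tangent_space A p. \<omega> p (X p) w = - differential A f p w)"

definition hamiltonian_vf ::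
  "('a, 'e::euclidean_space) chart set \<Rightarrow> ('a, 'e) form2 \<Rightarrow> ('a \<Rightarrow> real) \<Rightarrow> 'a \<Rightarrow> ('a, 'e) tvec" where
  "hamiltonian_vf A \<omega> f = (THE X. is_hamiltonian_vf A \<omega> f X)"


section \<open>The path space\<close>

text \<open>Paths are functions on \<open>[0,1]\<close>, i.e. extensional there, and likewise for vector fields along
  paths and for functions and vector fields on the path space.\<close>

type_synonym 'a path = "real \<Rightarrow> 'a"
type_synonym ('a, 'e) path_tvec = "real \<Rightarrow> ('a, 'e) tvec"

definition path_space ::
  "('a::topological_space, 'e::euclidean_space) chart set \<Rightarrow> 'a path set" where
  "path_space A = {\<gamma> \<in> extensional {0..1}. smooth_into A {0..1} \<gamma>}"

definition path_tangent_space ::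
  "('a, 'e::euclidean_space) chart set \<Rightarrow> 'a path \<Rightarrow> ('a, 'e) path_tvec set" where
  "path_tangent_space A \<gamma> =
     {v \<in> (\<Pi>\<^sub>E t\<in>{0..1}. tangent_space A (\<gamma> t)). smooth_along A {0..1} \<gamma> v}"

text \<open>Chen's differentiable structure: a plot is a map from a convex set with nonempty interior in
  some Euclidean space that is smooth jointly with the path parameter. The dimension of the parameter
  space is a type, so it cannot be quantified in a definition; statements about plots are made for an
  arbitrary type \<open>'d\<close>, which ranges over all Euclidean spaces as a free type variable of a theorem.\<close>

definition plot ::
  "('a::topological_space, 'e::euclidean_space) chart set \<Rightarrow> 'd::euclidean_space set \<Rightarrow>
     ('d \<Rightarrow> 'a path) \<Rightarrow> bool" where
  "plot A U \<alpha> \<longleftrightarrow>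
     convex U \<and> interior U \<noteq> {} \<and> (\<forall>u\<in>U. \<alpha> u \<in> path_space A) \<and>
     smooth_into A (U \<times> {0..1}) (\<lambda>(u, t). \<alpha> u t)"

definition path_vector_fields ::
  "'d::euclidean_space itself \<Rightarrow> ('a::topological_space, 'e::euclidean_space) chart set \<Rightarrow>
     ('a path \<Rightarrow> ('a, 'e) path_tvec) set" where
  "path_vector_fields (_ :: 'd itself) A =
     {X \<in> (\<Pi>\<^sub>E \<gamma>\<in>path_space A. path_tangent_space A \<gamma>).
        \<forall>(U :: 'd set) \<alpha>. plot A U \<alpha> \<longrightarrow>
          smooth_along A (U \<times> {0..1}) (\<lambda>(u, t). \<alpha> u t) (\<lambda>(u, t). X (\<alpha> u) t)}"

definition path_form :: "('a, 'e) form2 \<Rightarrow> 'a path \<Rightarrow> ('a, 'e) path_tvec \<Rightarrow> ('a, 'e) path_tvec \<Rightarrow> real" where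
  "path_form \<omega> \<gamma> v w = integral {0..1} (\<lambda>t. \<omega> (\<gamma> t) (v t) (w t))"

definition induced ::
  "('a::topological_space, 'e::euclidean_space) chart set \<Rightarrow> ('a \<Rightarrow> real) \<Rightarrow> 'a path \<Rightarrow> real" where
  "induced A f = (\<lambda>\<gamma>\<in>path_space A. integral {0..1} (\<lambda>t. f (\<gamma> t)))"

definition power_comb ::
  "('a::topological_space, 'e::euclidean_space) chart set \<Rightarrow> nat \<Rightarrow> (nat \<Rightarrow> real) \<Rightarrow>
     (nat \<Rightarrow> 'a \<Rightarrow> real) \<Rightarrow> (nat \<Rightarrow> nat) \<Rightarrow> 'a path \<Rightarrow> real" where
  "power_comb A k a F n = (\<lambda>\<gamma>\<in>path_space A. \<Sum>i<k. a i * induced A (F i) \<gamma> ^ n i)"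

definition Omega0 ::
  "('a::topological_space, 'e::euclidean_space) chart set \<Rightarrow> ('a path \<Rightarrow> real) set" where
  "Omega0 A = {power_comb A k a F n | k a F n. \<forall>i<k. F i \<in> C_inf A}"

text \<open>\<open>has_path_diff A \<phi> D\<close>: the 1-form \<open>D\<close> is obtained as the differential of \<open>\<phi>\<close> from the formula
  for induced functions by linearity and the Leibniz rule. Constants need no rule, being induced by
  constant functions.\<close>

inductive has_path_diff ::
  "('a::topological_space, 'e::euclidean_space) chart set \<Rightarrow> ('a path \<Rightarrow> real) \<Rightarrow>
     ('a path \<Rightarrow> ('a, 'e) path_tvec \<Rightarrow> real) \<Rightarrow> bool" for A where
  induced: "f \<in> C_inf A \<Longrightarrow>
     has_path_diff A (induced A f) (\<lambda>\<gamma> w. integral {0..1} (\<lambda>t. differential A f (\<gamma> t) (w t)))"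
| scale: "has_path_diff A \<phi> D \<Longrightarrow>
     has_path_diff A (\<lambda>\<gamma>\<in>path_space A. r * \<phi> \<gamma>) (\<lambda>\<gamma> w. r * D \<gamma> w)"
| add: "has_path_diff A \<phi> D \<Longrightarrow> has_path_diff A \<psi> E \<Longrightarrow>
     has_path_diff A (\<lambda>\<gamma>\<in>path_space A. \<phi> \<gamma> + \<psi> \<gamma>) (\<lambda>\<gamma> w. D \<gamma> w + E \<gamma> w)"
| leibniz: "has_path_diff A \<phi> D \<Longrightarrow> has_path_diff A \<psi> E \<Longrightarrow>
     has_path_diff A (\<lambda>\<gamma>\<in>path_space A. \<phi> \<gamma> * \<psi> \<gamma>) (\<lambda>\<gamma> w. \<phi> \<gamma> * E \<gamma> w + \<psi> \<gamma> * D \<gamma> w)"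

text \<open>For \<open>\<phi> \<in> Omega0 A\<close>, \<open>\<gamma> \<in> path_space A\<close> and \<open>w\<close> tangent at \<open>\<gamma>\<close>, the value \<open>D \<gamma> w\<close> does
  not depend on the derivation: it is determined by the derivatives of \<open>\<phi>\<close> along plots. For other
  arguments the result is unspecified.\<close>

definition path_diff ::
  "('a::topological_space, 'e::euclidean_space) chart set \<Rightarrow> ('a path \<Rightarrow> real) \<Rightarrow>
     'a path \<Rightarrow> ('a, 'e) path_tvec \<Rightarrow> real" where
  "path_diff A \<phi> \<gamma> w = (THE r. \<exists>D. has_path_diff A \<phi> D \<and> D \<gamma> w = r)"

definition is_path_hamiltonian_vf ::
  "'d::euclidean_space itself \<Rightarrow> ('a::topological_space, 'e::euclidean_space) chart set \<Rightarrow>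
     ('a, 'e) form2 \<Rightarrow> ('a path \<Rightarrow> real) \<Rightarrow> ('a path \<Rightarrow> ('a, 'e) path_tvec) \<Rightarrow> bool" where
  "is_path_hamiltonian_vf d A \<omega> \<phi> X \<longleftrightarrow>
     X \<in> path_vector_fields d A \<and>
     (\<forall>\<gamma>\<in>path_space A. \<forall>w\<in>path_tangent_space A \<gamma>.
        path_form \<omega> \<gamma> (X \<gamma>) w = - path_diff A \<phi> \<gamma> w)"

definition path_hamiltonian_vf ::
  "'d::euclidean_space itself \<Rightarrow> ('a::topological_space, 'e::euclidean_space) chart set \<Rightarrow>
     ('a, 'e) form2 \<Rightarrow> ('a path \<Rightarrow> real) \<Rightarrow> 'a path \<Rightarrow> ('a, 'e) path_tvec" where
  "path_hamiltonian_vf d A \<omega> \<phi> = (THE X. is_path_hamiltonian_vf d A \<omega> \<phi> X)"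

end

theory Submission
  imports Defs
begin

text \<open>
  The form \<open>path_form \<omega>\<close> is \<open>\<omega>\<close> integrated along the path, and the
  differential of \<open>induced A f\<close> is \<open>df\<close> integrated along the path. By the Leibniz rule the
  differential of \<open>power_comb A k a F n\<close> at \<open>\<gamma>\<close> is therefore the integral along \<open>\<gamma>\<close> of a
  linear combination of the \<open>dF\<^sub>i\<close>, whose coefficients depend on \<open>\<gamma>\<close> only, not on \<open>t\<close>.
  Replacing each \<open>dF\<^sub>i\<close> by the Hamiltonian vector field of \<open>F\<^sub>i\<close> gives the field
  \<open>power_comb_field\<close>, which is Hamiltonian because the equation holds under the integral sign
  (\<open>power_comb_field_hamiltonian\<close>). The product \<open>\<zeta>\<close> lies in \<open>Omega0 A\<close> by polarization,
  \<open>2 x y = (x + y)\<^sup>2 - x\<^sup>2 - y\<^sup>2\<close>, and the formula for its field is the general one together with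
  additivity of \<open>f \<mapsto> X\<^sub>f\<close> (\<open>induced_product_polarization\<close>).

  Four points carry the actual work.

  Existence of the fields \<open>X\<^sub>f\<close> on the manifold: in a chart the defining equation is a linear system
  whose matrix is smooth and invertible, so that the solution is smooth
  (\<open>smooth_on_linear_solve\<close>, \<open>hamiltonian_vf_exists\<close>).

  Uniqueness on the path space (\<open>path_form_nondegenerate\<close>): a covector field along \<open>\<gamma>\<close> whose
  integral vanishes against all bump fields is zero (\<open>covector_along_path_zero\<close>). A bump field is a
  coordinate vector field of a chart, cut off by a smooth function to a short interval of time.

  Well-definedness of \<open>path_diff\<close> (\<open>has_path_diff_unique\<close>): at a fixed path every differential
  derived for \<open>\<phi>\<close> is the integral of \<open>dh\<close> for a single function \<open>h\<close>. Two such differentials agree on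
  bump fields, because these are velocities of curves \<open>s \<mapsto> \<gamma>\<^sub>s\<close> of paths, and on them both
  differentials equal the derivative of \<open>\<phi> \<gamma>\<^sub>s\<close> at \<open>s = 0\<close>. By the preceding point
  they agree everywhere. The curves push \<open>\<gamma>\<close> along straight lines of a single chart.

  Smoothness of the field along plots: its coefficients are integrals of smooth functions depending on
  parameters (\<open>smooth_on_integral\<close>).
\<close>

section \<open>Smooth maps\<close>

lemma Ck_on_open_cong:
  assumes "Ck_on_open k S f" "open S" "\<And>x. x \<in> S \<Longrightarrow> g x = f x"
  shows "Ck_on_open k S g"
  using assms
proof (induction k arbitrary: f g)
  case 0
  then show ?case by (simp cong: continuous_on_cong)
next
  case (Suc k)
  have D: "(g has_derivative frechet_derivative f (at x)) (at x)" if "x \<in> S" for x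
  proof -
    have "(f has_derivative frechet_derivative f (at x)) (at x)"
      using Suc.prems(1) that by (simp add: frechet_derivative_works)
    then show ?thesis
      by (rule has_derivative_transform_within_open[OF _ Suc.prems(2) that]) (simp add: Suc.prems(3))
  qed
  have "Ck_on_open k S (\<lambda>x. frechet_derivative g (at x) u)" for u
  proof (rule Suc.IH[where f = "\<lambda>x. frechet_derivative f (at x) u"])
    show "Ck_on_open k S (\<lambda>x. frechet_derivative f (at x) u)" using Suc.prems(1) by simp
    show "frechet_derivative g (at x) u = frechet_derivative f (at x) u" if "x \<in> S" for x
      using frechet_derivative_at[OF D[OF that]] by simp
  qed fact
  then show ?case using D by (auto simp: differentiable_def)
qed

text \<open>The recursion in the definition of \<open>Ck_on_open\<close> speaks about \<open>frechet_derivative\<close>. The closure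
  properties below follow more easily when any derivative supplied by a differentiation rule may be
  used in its place.\<close>
lemma Ck_on_open_SucI:
  assumes "open S" "\<And>x. x \<in> S \<Longrightarrow> (f has_derivative f' x) (at x)"
    and "\<And>u. Ck_on_open k S (\<lambda>x. f' x u)"
  shows "Ck_on_open (Suc k) S f"
proof -
  have "Ck_on_open k S (\<lambda>x. frechet_derivative f (at x) u)" for u
    by (rule Ck_on_open_cong[OF assms(3)[of u] assms(1)])
      (simp add: frechet_derivative_at[OF assms(2), symmetric])
  then show ?thesis using assms(2) by (auto simp: differentiable_def)
qed

lemma Ck_on_open_SucD:
  assumes "Ck_on_open (Suc k) S f"
  shows "x \<in> S \<Longrightarrow> (f has_derivative frechet_derivative f (at x)) (at x)"
    and "Ck_on_open k S (\<lambda>x. frechet_derivative f (at x) u)"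
  using assms by (auto simp: frechet_derivative_works)

lemma Ck_on_open_pred: "Ck_on_open (Suc k) S f \<Longrightarrow> Ck_on_open k S f"
proof (induction k arbitrary: f)
  case 0
  have "continuous (at x) f" if "x \<in> S" for x
    using Ck_on_open_SucD(1)[OF 0 that] by (rule has_derivative_continuous)
  then show ?case by (simp add: continuous_at_imp_continuous_on)
qed auto

lemma Ck_on_open_subset: "Ck_on_open k S f \<Longrightarrow> T \<subseteq> S \<Longrightarrow> Ck_on_open k T f"
  by (induction k arbitrary: f) (auto intro: continuous_on_subset)

lemma Ck_on_open_local:
  assumes "\<And>x. x \<in> S \<Longrightarrow> \<exists>N. open N \<and> x \<in> N \<and> Ck_on_open k N f"
  shows "Ck_on_open k S f"
  using assms
proof (induction k arbitrary: f)
  case 0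
  then show ?case
    by (auto intro!: continuous_at_imp_continuous_on) (metis continuous_on_eq_continuous_at)
next
  case (Suc k)
  have "Ck_on_open k S (\<lambda>x. frechet_derivative f (at x) u)" for u
    by (rule Suc.IH) (use Suc.prems in fastforce)
  then show ?case using Suc.prems by fastforce
qed

lemma Ck_on_open_const: "Ck_on_open k S (\<lambda>x. a)"
  by (induction k arbitrary: a) auto

lemma Ck_on_open_add:
  assumes "open S" "Ck_on_open k S f" "Ck_on_open k S g"
  shows "Ck_on_open k S (\<lambda>x. f x + g x)"
  using assms
proof (induction k arbitrary: f g)
  case (Suc k)
  show ?case
    by (rule Ck_on_open_SucI[OF \<open>open S\<close>
          has_derivative_add[OF Ck_on_open_SucD(1)[OF Suc.prems(2)] Ck_on_open_SucD(1)[OF Suc.prems(3)]]])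
      (use Suc in \<open>auto intro!: Suc.IH\<close>)
qed (auto intro: continuous_on_add)

lemma Ck_on_open_linear:
  assumes "bounded_linear L" "open S" "Ck_on_open k S f"
  shows "Ck_on_open k S (\<lambda>x. L (f x))"
  using assms
proof (induction k arbitrary: f)
  case (Suc k)
  show ?case
    by (rule Ck_on_open_SucI[OF \<open>open S\<close>
          bounded_linear.has_derivative[OF assms(1) Ck_on_open_SucD(1)[OF Suc.prems(3)]]])
      (use Suc in \<open>auto intro!: Suc.IH\<close>)
qed (auto intro: bounded_linear.continuous_on)

text \<open>The derivative of \<open>B f g\<close> is a sum of two terms of the same shape, each with one
  factor differentiated. To these the induction hypothesis applies once the smoothness of the other
  factor is lowered by one order.\<close>
lemma Ck_on_open_bilinear:
  assumes "bounded_bilinear B" "open S" "Ck_on_open k S f" "Ck_on_open k S g"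
  shows "Ck_on_open k S (\<lambda>x. B (f x) (g x))"
  using assms
proof (induction k arbitrary: f g)
  case 0
  then show ?case by (auto intro: bounded_bilinear.continuous_on)
next
  case (Suc k)
  have "Ck_on_open k S f" "Ck_on_open k S g"
    using Suc.prems by (auto intro: Ck_on_open_pred)
  then show ?case
    by (intro Ck_on_open_SucI[OF \<open>open S\<close>
          bounded_bilinear.FDERIV[OF assms(1) Ck_on_open_SucD(1)[OF Suc.prems(3)]
            Ck_on_open_SucD(1)[OF Suc.prems(4)]]])
      (use Suc in \<open>auto intro!: Ck_on_open_add Suc.IH\<close>)
qed

lemma Ck_on_open_sum:
  assumes "open S" "\<And>i. i \<in> I \<Longrightarrow> Ck_on_open k S (f i)"
  shows "Ck_on_open k S (\<lambda>x. \<Sum>i\<in>I. f i x)"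
  using assms(2)
  by (induction I rule: infinite_finite_induct)
    (auto intro: Ck_on_open_const Ck_on_open_add[OF assms(1)])

lemma Ck_on_open_id: "open S \<Longrightarrow> Ck_on_open k S (\<lambda>x. x)"
  by (cases k) (auto intro!: Ck_on_open_SucI derivative_eq_intros simp: Ck_on_open_const)

text \<open>Expanding in a basis turns statements about a linear map depending on a point into statements
  about finitely many functions of that point. This is how smoothness of expressions such as
  \<open>Df(x)(v(x))\<close>, where both \<open>Df\<close> and the argument \<open>v\<close> vary, is reduced to sums and products.\<close>
lemma linear_eq_sum_Basis:
  fixes L :: "'b::euclidean_space \<Rightarrow> 'c::real_vector"
  assumes "linear L"
  shows "L u = (\<Sum>b\<in>Basis. (u \<bullet> b) *\<^sub>R L b)"
proof -
  have "L u = L (\<Sum>b\<in>Basis. (u \<bullet> b) *\<^sub>R b)" by (simp add: euclidean_representation)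
  also have "\<dots> = (\<Sum>b\<in>Basis. (u \<bullet> b) *\<^sub>R L b)"
    by (simp add: linear_sum[OF assms] linear_scale[OF assms])
  finally show ?thesis .
qed

text \<open>The chain rule expresses a directional derivative of \<open>f \<circ> g\<close> through products of components of
  \<open>Dg\<close> with \<open>(D\<^sub>b f) \<circ> g\<close>, where \<open>b\<close> is a fixed basis vector. The induction hypothesis applies to
  the latter, which is why it is stated for arbitrary \<open>f\<close> and fixed \<open>g\<close>.\<close>
lemma Ck_on_open_compose:
  fixes g :: "'b::euclidean_space \<Rightarrow> 'c::euclidean_space" and f :: "'c \<Rightarrow> 'd::real_normed_vector"
  assumes "open S" "open T" "Ck_on_open k S g" "g ` S \<subseteq> T" "Ck_on_open k T f"
  shows "Ck_on_open k S (\<lambda>x. f (g x))"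
  using assms
proof (induction k arbitrary: f)
  case 0
  then show ?case using continuous_on_compose2 by auto
next
  case (Suc k)
  have g: "Ck_on_open k S g" using Suc.prems by (blast intro: Ck_on_open_pred)
  have D: "((\<lambda>x. f (g x)) has_derivative
      (\<lambda>u. \<Sum>b\<in>Basis. (frechet_derivative g (at x) u \<bullet> b) *\<^sub>R frechet_derivative f (at (g x)) b)) (at x)"
    if "x \<in> S" for x
  proof -
    have df: "(f has_derivative frechet_derivative f (at (g x))) (at (g x))"
      using Ck_on_open_SucD(1)[OF Suc.prems(5)] Suc.prems(4) that by blast
    have "((\<lambda>x. f (g x)) has_derivative
      (\<lambda>u. frechet_derivative f (at (g x)) (frechet_derivative g (at x) u))) (at x)"
      by (rule has_derivative_compose[OF Ck_on_open_SucD(1)[OF Suc.prems(3) that] df])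
    then show ?thesis
      by (subst (asm) linear_eq_sum_Basis[OF has_derivative_linear[OF df]])
  qed
  show ?case
  proof (rule Ck_on_open_SucI[OF \<open>open S\<close> D])
    show "Ck_on_open k S (\<lambda>x. \<Sum>b\<in>Basis. (frechet_derivative g (at x) u \<bullet> b) *\<^sub>R
             frechet_derivative f (at (g x)) b)" for u
      by (intro Ck_on_open_sum Ck_on_open_bilinear[OF bounded_bilinear_scaleR]
          Ck_on_open_linear[OF bounded_linear_inner_left]
          Suc.IH[where f = "\<lambda>y. frechet_derivative f (at y) _"] g)
        (use Suc.prems in auto)
  qed
qed

lemma smooth_onE:
  assumes "smooth_on S h" "x \<in> S"
  obtains N H where "open N" "x \<in> N" "\<And>k. Ck_on_open k N H" "\<And>y. y \<in> N \<Longrightarrow> y \<in> S \<Longrightarrow> H y = h y"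
proof -
  from assms obtain N H where "open N \<and> x \<in> N \<and> (\<forall>k. Ck_on_open k N H) \<and> (\<forall>y\<in>N \<inter> S. H y = h y)"
    unfolding smooth_on_def by blast
  then show ?thesis by (intro that[of N H]) simp_all
qed

lemma smooth_onI:
  assumes "\<And>x. x \<in> S \<Longrightarrow> \<exists>N H. open N \<and> x \<in> N \<and> (\<forall>k. Ck_on_open k N H) \<and> (\<forall>y\<in>N \<inter> S. H y = h y)"
  shows "smooth_on S h"
  using assms unfolding smooth_on_def by blast

text \<open>Restrictions of paths to the preimage of a chart domain live on relatively open subsets of
  \<open>[0,1]\<close>; statements about them are glued this way.\<close>
lemma smooth_on_local:
  assumes "\<And>x. x \<in> S \<Longrightarrow> \<exists>N. open N \<and> x \<in> N \<and> smooth_on (S \<inter> N) h"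
  shows "smooth_on S h"
proof (rule smooth_onI)
  fix x assume x: "x \<in> S"
  obtain N where N: "open N" "x \<in> N" "smooth_on (S \<inter> N) h" using assms[OF x] by blast
  obtain N' H where H: "open N'" "x \<in> N'" "\<And>k. Ck_on_open k N' H"
    "\<And>y. y \<in> N' \<Longrightarrow> y \<in> S \<inter> N \<Longrightarrow> H y = h y"
    using smooth_onE[OF N(3), of x] N(2) x by (metis IntI)
  then show "\<exists>N H. open N \<and> x \<in> N \<and> (\<forall>k. Ck_on_open k N H) \<and> (\<forall>y\<in>N \<inter> S. H y = h y)"
    using N by (intro exI[of _ "N \<inter> N'"] exI[of _ H]) (auto intro: Ck_on_open_subset)
qed

lemma smooth_on_cong:
  assumes "smooth_on S f" "\<And>x. x \<in> S \<Longrightarrow> g x = f x"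
  shows "smooth_on S g"
proof (rule smooth_onI)
  fix x assume "x \<in> S"
  then obtain N H where "open N" "x \<in> N" "\<And>k. Ck_on_open k N H"
    "\<And>y. y \<in> N \<Longrightarrow> y \<in> S \<Longrightarrow> H y = f y" using smooth_onE[OF assms(1)] by metis
  then show "\<exists>N H. open N \<and> x \<in> N \<and> (\<forall>k. Ck_on_open k N H) \<and> (\<forall>y\<in>N \<inter> S. H y = g y)"
    using assms(2) by (intro exI[of _ N] exI[of _ H]) simp
qed

lemma smooth_on_subset:
  assumes "smooth_on S f" "T \<subseteq> S"
  shows "smooth_on T f"
proof (rule smooth_onI)
  fix x assume "x \<in> T"
  then obtain N H where "open N" "x \<in> N" "\<And>k. Ck_on_open k N H"
    "\<And>y. y \<in> N \<Longrightarrow> y \<in> S \<Longrightarrow> H y = f y" using smooth_onE[OF assms(1)] assms(2) by (metis subsetD)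
  then show "\<exists>N H. open N \<and> x \<in> N \<and> (\<forall>k. Ck_on_open k N H) \<and> (\<forall>y\<in>N \<inter> T. H y = f y)"
    using assms(2) by (intro exI[of _ N] exI[of _ H]) auto
qed

lemma Ck_imp_smooth_on: "open S \<Longrightarrow> (\<And>k. Ck_on_open k S f) \<Longrightarrow> smooth_on S f"
  unfolding smooth_on_def by blast

lemma smooth_on_open_imp_Ck:
  assumes "smooth_on S f" "open S"
  shows "Ck_on_open k S f"
proof (rule Ck_on_open_local)
  fix x assume "x \<in> S"
  then obtain N H where H: "open N" "x \<in> N" "\<And>k. Ck_on_open k N H"
    "\<And>y. y \<in> N \<Longrightarrow> y \<in> S \<Longrightarrow> H y = f y" using smooth_onE[OF assms(1)] by metis
  have "Ck_on_open k (N \<inter> S) f"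
    by (rule Ck_on_open_cong[where f = H]) (use H assms in \<open>auto intro: Ck_on_open_subset\<close>)
  then show "\<exists>N. open N \<and> x \<in> N \<and> Ck_on_open k N f"
    using H assms \<open>x \<in> S\<close> by (intro exI[of _ "N \<inter> S"]) auto
qed

lemma smooth_on_open_has_derivative:
  assumes "smooth_on S f" "open S" "x \<in> S"
  shows "(f has_derivative frechet_derivative f (at x)) (at x)"
  by (rule Ck_on_open_SucD(1)[OF smooth_on_open_imp_Ck[OF assms(1,2)] assms(3)])

lemma smooth_on_frechet_derivative:
  assumes "smooth_on S f" "open S"
  shows "smooth_on S (\<lambda>x. frechet_derivative f (at x) u)"
  by (rule Ck_imp_smooth_on[OF assms(2) Ck_on_open_SucD(2)[OF smooth_on_open_imp_Ck[OF assms]]])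

lemma smooth_on_imp_continuous_on:
  assumes "smooth_on S f"
  shows "continuous_on S f"
  unfolding continuous_on_eq_continuous_within
proof
  fix x assume x: "x \<in> S"
  obtain N H where H: "open N" "x \<in> N" "\<And>k. Ck_on_open k N H"
    "\<And>y. y \<in> N \<Longrightarrow> y \<in> S \<Longrightarrow> H y = f y" using smooth_onE[OF assms x] by metis
  have "continuous_on N H" using H(3)[of 0] by simp
  then have "continuous (at x within S) H"
    using H by (simp add: continuous_on_eq_continuous_at continuous_at_imp_continuous_at_within)
  moreover have "eventually (\<lambda>y. H y = f y) (at x within S)"
    using H by (auto simp: eventually_at_topological)
  ultimately show "continuous (at x within S) f"
    using H(2,4) x by (auto simp: continuous_within intro: Lim_transform_eventually)
qed

lemma smooth_on_const: "smooth_on S (\<lambda>x. a)"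
  by (rule smooth_onI) (intro exI[of _ UNIV] exI[of _ "\<lambda>x. a"], simp add: Ck_on_open_const)

lemma smooth_on_linear_map:
  assumes "bounded_linear L"
  shows "smooth_on S L"
proof -
  have "smooth_on UNIV L"
    by (rule Ck_imp_smooth_on) (auto intro: Ck_on_open_linear[OF assms open_UNIV Ck_on_open_id])
  then show ?thesis by (rule smooth_on_subset) simp
qed

lemma smooth_on_id: "smooth_on S (\<lambda>x. x)"
  by (rule smooth_on_linear_map[OF bounded_linear_ident])

lemma smooth_on_bilinear:
  assumes B: "bounded_bilinear B" and f: "smooth_on S f" and g: "smooth_on S g"
  shows "smooth_on S (\<lambda>x. B (f x) (g x))"
proof (rule smooth_onI)
  fix x assume x: "x \<in> S"
  obtain M F where F: "open M" "x \<in> M" "\<And>k. Ck_on_open k M F"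
    "\<And>y. y \<in> M \<Longrightarrow> y \<in> S \<Longrightarrow> F y = f y" using smooth_onE[OF f x] by metis
  obtain N G where G: "open N" "x \<in> N" "\<And>k. Ck_on_open k N G"
    "\<And>y. y \<in> N \<Longrightarrow> y \<in> S \<Longrightarrow> G y = g y" using smooth_onE[OF g x] by metis
  show "\<exists>N H. open N \<and> x \<in> N \<and> (\<forall>k. Ck_on_open k N H) \<and> (\<forall>y\<in>N \<inter> S. H y = B (f y) (g y))"
    using F G by (intro exI[of _ "M \<inter> N"] exI[of _ "\<lambda>x. B (F x) (G x)"])
      (auto intro!: Ck_on_open_bilinear[OF B] intro: Ck_on_open_subset)
qed

lemma smooth_on_add:
  assumes f: "smooth_on S f" and g: "smooth_on S g"
  shows "smooth_on S (\<lambda>x. f x + g x)"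
proof (rule smooth_onI)
  fix x assume x: "x \<in> S"
  obtain M F where F: "open M" "x \<in> M" "\<And>k. Ck_on_open k M F"
    "\<And>y. y \<in> M \<Longrightarrow> y \<in> S \<Longrightarrow> F y = f y" using smooth_onE[OF f x] by metis
  obtain N G where G: "open N" "x \<in> N" "\<And>k. Ck_on_open k N G"
    "\<And>y. y \<in> N \<Longrightarrow> y \<in> S \<Longrightarrow> G y = g y" using smooth_onE[OF g x] by metis
  show "\<exists>N H. open N \<and> x \<in> N \<and> (\<forall>k. Ck_on_open k N H) \<and> (\<forall>y\<in>N \<inter> S. H y = f y + g y)"
    using F G by (intro exI[of _ "M \<inter> N"] exI[of _ "\<lambda>x. F x + G x"])
      (auto intro!: Ck_on_open_add intro: Ck_on_open_subset)
qed

lemma smooth_on_compose: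
  fixes g :: "'b::euclidean_space \<Rightarrow> 'c::euclidean_space" and f :: "'c \<Rightarrow> 'd::real_normed_vector"
  assumes g: "smooth_on S g" and f: "smooth_on T f" and im: "\<And>x. x \<in> S \<Longrightarrow> g x \<in> T"
  shows "smooth_on S (\<lambda>x. f (g x))"
proof (rule smooth_onI)
  fix x assume x: "x \<in> S"
  obtain M G where G: "open M" "x \<in> M" "\<And>k. Ck_on_open k M G"
    "\<And>y. y \<in> M \<Longrightarrow> y \<in> S \<Longrightarrow> G y = g y" using smooth_onE[OF g x] by metis
  obtain N F where F: "open N" "g x \<in> N" "\<And>k. Ck_on_open k N F"
    "\<And>y. y \<in> N \<Longrightarrow> y \<in> T \<Longrightarrow> F y = f y" using smooth_onE[OF f im[OF x]] by metis
  have "continuous_on M G" using G(3)[of 0] by simp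
  then have o: "open (M \<inter> G -` N)" using G F by (simp add: continuous_open_preimage)
  have "Ck_on_open k (M \<inter> G -` N) (\<lambda>x. F (G x))" for k
    by (rule Ck_on_open_compose[OF o F(1) Ck_on_open_subset[OF G(3)] _ F(3)]) auto
  then show "\<exists>N H. open N \<and> x \<in> N \<and> (\<forall>k. Ck_on_open k N H) \<and> (\<forall>y\<in>N \<inter> S. H y = f (g y))"
    using o F G x im by (intro exI[of _ "M \<inter> G -` N"] exI[of _ "\<lambda>x. F (G x)"]) auto
qed

lemma smooth_on_linear:
  fixes f :: "'b::euclidean_space \<Rightarrow> 'c::euclidean_space"
  assumes "bounded_linear L" "smooth_on S f"
  shows "smooth_on S (\<lambda>x. L (f x))"
  by (rule smooth_on_compose[OF assms(2) smooth_on_linear_map[OF assms(1), of UNIV]]) simp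

lemmas smooth_on_scaleR = smooth_on_bilinear[OF bounded_bilinear_scaleR]
lemmas smooth_on_inner = smooth_on_bilinear[OF bounded_bilinear_inner]

lemma smooth_on_mult:
  fixes f g :: "_ \<Rightarrow> real"
  shows "smooth_on S f \<Longrightarrow> smooth_on S g \<Longrightarrow> smooth_on S (\<lambda>x. f x * g x)"
  by (rule smooth_on_bilinear[OF bounded_bilinear_mult])

lemma smooth_on_power:
  fixes f :: "_ \<Rightarrow> real"
  shows "smooth_on S f \<Longrightarrow> smooth_on S (\<lambda>x. f x ^ n)"
  by (induction n) (auto intro: smooth_on_const smooth_on_mult)

lemma smooth_on_sum:
  assumes "\<And>i. i \<in> I \<Longrightarrow> smooth_on S (f i)"
  shows "smooth_on S (\<lambda>x. \<Sum>i\<in>I. f i x)"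
  using assms by (induction I rule: infinite_finite_induct) (auto intro: smooth_on_const smooth_on_add)

section \<open>Linear systems with smooth coefficients\<close>

lemma linear_diff_norm_le:
  fixes V W :: "'b::euclidean_space \<Rightarrow> 'c::real_normed_vector"
  assumes "linear V" "linear W"
  shows "norm (V v - W v) \<le> (\<Sum>b\<in>Basis. norm (V b - W b)) * norm v"
proof -
  have "linear (\<lambda>v. V v - W v)" using assms by (rule linear_compose_sub)
  from linear_eq_sum_Basis[OF this, of v]
  have "norm (V v - W v) = norm (\<Sum>b\<in>Basis. (v \<bullet> b) *\<^sub>R (V b - W b))" by simp
  also have "\<dots> \<le> (\<Sum>b\<in>Basis. norm ((v \<bullet> b) *\<^sub>R (V b - W b)))" by (rule norm_sum)
  also have "\<dots> \<le> (\<Sum>b\<in>Basis. norm (V b - W b) * norm v)"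
    by (rule sum_mono) (simp add: mult.commute[of "norm (_ - _)"] mult_right_mono Basis_le_norm)
  finally show ?thesis by (simp add: sum_distrib_right)
qed

text \<open>An injective linear map on a finite-dimensional space is bounded below, and this persists for
  nearby maps with half the constant. This bounds the inverses uniformly near \<open>x0\<close>.\<close>
lemma eventually_linear_bounded_below:
  fixes W :: "'b::t2_space \<Rightarrow> 'e::euclidean_space \<Rightarrow> 'c::euclidean_space"
  assumes "open S" "x0 \<in> S" "\<And>x. x \<in> S \<Longrightarrow> linear (W x)" "inj (W x0)"
    and "\<And>v. isCont (\<lambda>x. W x v) x0"
  obtains c where "c > 0" "\<forall>\<^sub>F x in at x0. \<forall>v. c * norm v \<le> norm (W x v)"
    "((\<lambda>x. \<Sum>b\<in>Basis. norm (W x b - W x0 b)) \<longlongrightarrow> 0) (at x0)"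
proof -
  obtain B where B: "B > 0" "\<And>v. B * norm v \<le> norm (W x0 v)"
    using linear_inj_bounded_below_pos assms(2-4) by metis
  have "((\<lambda>x. \<Sum>b\<in>Basis. norm (W x b - W x0 b)) \<longlongrightarrow> (\<Sum>b\<in>(Basis::'e set). norm (W x0 b - W x0 b))) (at x0)"
    using assms(5) by (intro tendsto_intros) (simp_all add: isCont_def)
  then have lim: "((\<lambda>x. \<Sum>b\<in>Basis. norm (W x b - W x0 b)) \<longlongrightarrow> 0) (at x0)" by simp
  have "\<forall>\<^sub>F x in at x0. (\<Sum>b\<in>Basis. norm (W x b - W x0 b)) < B / 2"
    using order_tendstoD(2)[OF lim, of "B/2"] B by simp
  moreover have "\<forall>\<^sub>F x in at x0. x \<in> S"
    using assms(1,2) by (auto simp: eventually_at_topological)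
  ultimately have "\<forall>\<^sub>F x in at x0. \<forall>v. B / 2 * norm v \<le> norm (W x v)"
  proof eventually_elim
    case (elim x)
    show ?case
    proof
      fix v
      have "norm (W x v - W x0 v) \<le> (\<Sum>b\<in>Basis. norm (W x b - W x0 b)) * norm v"
        by (rule linear_diff_norm_le) (use assms elim in auto)
      also have "\<dots> \<le> B / 2 * norm v" using elim by (intro mult_right_mono) auto
      finally have "norm (W x v - W x0 v) \<le> B / 2 * norm v" .
      moreover have "norm (W x0 v) \<le> norm (W x v - W x0 v) + norm (W x v)"
        by (metis norm_minus_commute norm_triangle_sub add.commute)
      ultimately show "B / 2 * norm v \<le> norm (W x v)" using B(2)[of v] by (simp add: field_simps)
    qed
  qed
  then show ?thesis using that[of "B/2"] B lim by simp
qed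

text \<open>The increment of the solution satisfies \<open>W(x) (X(x) - X(x\<^sub>0)) = F(x) - W(x) X(x\<^sub>0)\<close>. The right-hand
  side tends to 0, and \<open>W(x)\<close> is bounded below.\<close>
lemma isCont_linear_solve:
  fixes W :: "'b::t2_space \<Rightarrow> 'e::euclidean_space \<Rightarrow> 'c::euclidean_space"
  assumes "open S" "x0 \<in> S" and lin: "\<And>x. x \<in> S \<Longrightarrow> linear (W x)" and "inj (W x0)"
    and W: "\<And>v. isCont (\<lambda>x. W x v) x0" and F: "isCont F x0"
    and sol: "\<And>x. x \<in> S \<Longrightarrow> W x (X x) = F x"
  shows "isCont X x0"
proof -
  obtain c where c: "c > 0" "\<forall>\<^sub>F x in at x0. \<forall>v. c * norm v \<le> norm (W x v)"
    using eventually_linear_bounded_below[OF assms(1-5)] by metis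
  have "((\<lambda>x. norm (F x - W x (X x0)) / c) \<longlongrightarrow> norm (F x0 - W x0 (X x0)) / c) (at x0)"
    using F W[of "X x0"] c by (intro tendsto_intros) (auto simp: isCont_def)
  then have lim: "((\<lambda>x. norm (F x - W x (X x0)) / c) \<longlongrightarrow> 0) (at x0)"
    using sol assms(2) by simp
  have "\<forall>\<^sub>F x in at x0. x \<in> S"
    using assms(1,2) by (auto simp: eventually_at_topological)
  with c(2) have "\<forall>\<^sub>F x in at x0. norm (X x - X x0) \<le> norm (F x - W x (X x0)) / c"
  proof eventually_elim
    case (elim x)
    have e: "W x (X x - X x0) = F x - W x (X x0)"
      using elim sol by (simp add: linear_diff[OF lin])
    show ?case
      using elim(1)[rule_format, of "X x - X x0", unfolded e] c(1) by (simp add: pos_le_divide_eq mult.commute)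
  qed
  then have "((\<lambda>x. X x - X x0) \<longlongrightarrow> 0) (at x0)" by (rule Lim_null_comparison[OF _ lim])
  then show ?thesis by (simp add: isCont_def LIM_zero_iff)
qed

text \<open>Formally differentiating \<open>W X = F\<close> at \<open>x\<^sub>0\<close> shows that the derivative \<open>Z\<close> must satisfy
  \<open>W(x\<^sub>0) Z = G'\<close>, where \<open>G'\<close> is the derivative of \<open>F - W X(x\<^sub>0)\<close> with \<open>X(x\<^sub>0)\<close> held fixed. The
  remainder \<open>X(x) - X(x\<^sub>0) - Z (x - x\<^sub>0)\<close> is estimated by applying \<open>W(x)\<close> to it and using that
  \<open>W(x)\<close> is bounded below.\<close>
lemma has_derivative_linear_solve:
  fixes W :: "'b::real_normed_vector \<Rightarrow> 'e::euclidean_space \<Rightarrow> 'e"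
  assumes "open S" "x0 \<in> S" and lin: "\<And>x. x \<in> S \<Longrightarrow> linear (W x)" and inj: "inj (W x0)"
    and W: "\<And>v. isCont (\<lambda>x. W x v) x0"
    and sol: "\<And>x. x \<in> S \<Longrightarrow> W x (X x) = F x"
    and G: "((\<lambda>x. F x - W x (X x0)) has_derivative G') (at x0)"
  obtains Z where "(X has_derivative Z) (at x0)" "\<And>u. W x0 (Z u) = G' u"
proof -
  have "surj (W x0)" by (rule linear_injective_imp_surjective[OF lin[OF assms(2)] inj]) simp
  then obtain V where V: "linear V" "W x0 \<circ> V = id"
    using linear_surjective_right_inverse[OF lin[OF assms(2)]] by metis
  define Z where "Z = V \<circ> G'"
  have bl: "bounded_linear Z"
    using bounded_linear_compose[OF _ has_derivative_bounded_linear[OF G], of V] V(1)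
    by (simp add: Z_def comp_def linear_conv_bounded_linear)
  have WZ: "W x0 (Z u) = G' u" for u
    using fun_cong[OF V(2), of "G' u"] by (simp add: Z_def)
  obtain K where K: "\<And>u. norm (Z u) \<le> norm u * K"
    using bounded_linear.bounded[OF bl] by blast
  obtain c where c: "c > 0" "\<forall>\<^sub>F x in at x0. \<forall>v. c * norm v \<le> norm (W x v)"
    "((\<lambda>x. \<Sum>b\<in>Basis. norm (W x b - W x0 b)) \<longlongrightarrow> 0) (at x0)"
    using eventually_linear_bounded_below[OF assms(1-5)] by metis
  let ?s = "\<lambda>x. \<Sum>b\<in>Basis. norm (W x b - W x0 b)"
  let ?G = "\<lambda>x. F x - W x (X x0)"
  let ?g = "\<lambda>x. (1 / norm (x - x0)) *\<^sub>R (?G x - (?G x0 + G' (x - x0)))"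
  have g: "(?g \<longlongrightarrow> 0) (at x0)" using G by (simp add: has_derivative_at2)
  have "((\<lambda>x. (norm (?g x) + ?s x * K) / c) \<longlongrightarrow> (norm (0::'e) + 0 * K) / c) (at x0)"
    using c g by (intro tendsto_intros) auto
  then have lim: "((\<lambda>x. (norm (?g x) + ?s x * K) / c) \<longlongrightarrow> 0) (at x0)" by simp
  have "\<forall>\<^sub>F x in at x0. x \<in> S \<and> x \<noteq> x0"
    using assms(1,2) by (auto simp: eventually_at_topological)
  with c(2)
  have "\<forall>\<^sub>F x in at x0. norm ((1 / norm (x - x0)) *\<^sub>R (X x - (X x0 + Z (x - x0)))) \<le> (norm (?g x) + ?s x * K) / c"
  proof eventually_elim
    case (elim x)
    let ?R = "X x - (X x0 + Z (x - x0))" and ?n = "norm (x - x0)"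
    have n: "?n > 0" using elim by simp
    have "W x ?R = (?G x - (?G x0 + G' (x - x0))) - (W x (Z (x - x0)) - W x0 (Z (x - x0)))"
      using elim sol assms(2) by (simp add: linear_diff[OF lin] linear_add[OF lin] WZ algebra_simps)
    then have "c * norm ?R \<le> norm (?G x - (?G x0 + G' (x - x0))) + norm (W x (Z (x - x0)) - W x0 (Z (x - x0)))"
      using elim(1) by (metis norm_triangle_ineq4 order_trans)
    also have "norm (W x (Z (x - x0)) - W x0 (Z (x - x0))) \<le> ?s x * norm (Z (x - x0))"
      by (rule linear_diff_norm_le) (use lin assms(2) elim in auto)
    also have "\<dots> \<le> ?s x * (?n * K)"
      by (intro mult_left_mono K sum_nonneg) auto
    finally have "c * norm ?R \<le> norm (?G x - (?G x0 + G' (x - x0))) + ?s x * (?n * K)" by simp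
    moreover have "norm (?G x - (?G x0 + G' (x - x0))) = ?n * norm (?g x)"
      using n by (simp only: norm_scaleR) simp
    ultimately have "c * norm ?R \<le> ?n * (norm (?g x) + ?s x * K)" by (simp only: algebra_simps)
    moreover have "r / ?n \<le> Q / c" if "c * r \<le> ?n * Q" for r Q
      using that n c(1) by (simp add: divide_simps mult.commute)
    ultimately have "norm ?R / ?n \<le> (norm (?g x) + ?s x * K) / c" by blast
    moreover have "norm ((1 / ?n) *\<^sub>R ?R) = norm ?R / ?n" by (simp only: norm_scaleR) simp
    ultimately show ?case by simp
  qed
  then have "((\<lambda>x. (1 / norm (x - x0)) *\<^sub>R (X x - (X x0 + Z (x - x0)))) \<longlongrightarrow> 0) (at x0)"
    by (rule Lim_null_comparison[OF _ lim])
  then have "(X has_derivative Z) (at x0)" using bl by (simp add: has_derivative_at2)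
  then show ?thesis using that WZ by blast
qed

lemma Ck_on_open_diff:
  assumes "open S" "Ck_on_open k S f" "Ck_on_open k S g"
  shows "Ck_on_open k S (\<lambda>x. f x - g x)"
  using Ck_on_open_add[OF assms(1,2) Ck_on_open_linear[OF _ assms(1,3), of uminus]]
  by (simp add: bounded_linear_minus[OF bounded_linear_ident])

text \<open>A directional derivative of \<open>X\<close> again solves a linear system with the same matrix \<open>W\<close>, whose
  right-hand side involves derivatives of \<open>W\<close> and \<open>F\<close> and \<open>X\<close> itself but no derivative of \<open>X\<close>. Hence
  induction on the order of smoothness works, for all right-hand sides simultaneously.\<close>
lemma smooth_on_linear_solve:
  fixes W :: "'b::euclidean_space \<Rightarrow> 'e::euclidean_space \<Rightarrow> 'e"
  assumes S: "open S" and lin: "\<And>x. x \<in> S \<Longrightarrow> linear (W x)" and inj: "\<And>x. x \<in> S \<Longrightarrow> inj (W x)"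
    and W: "\<And>v. smooth_on S (\<lambda>x. W x v)" and F: "smooth_on S F"
    and sol: "\<And>x. x \<in> S \<Longrightarrow> W x (X x) = F x"
  shows "smooth_on S X"
proof -
  have Wd: "((\<lambda>x. W x v) has_derivative frechet_derivative (\<lambda>x. W x v) (at x)) (at x)" if "x \<in> S" for x v
    by (rule smooth_on_open_has_derivative[OF W S that])
  then have Wc: "isCont (\<lambda>x. W x v) x" if "x \<in> S" for x v
    using that has_derivative_continuous by blast
  have "Ck_on_open k S X" if "Ck_on_open k S F" "\<And>x. x \<in> S \<Longrightarrow> W x (X x) = F x" for k X F
    using that
  proof (induction k arbitrary: X F)
    case 0
    have "isCont X x" if "x \<in> S" for x
      by (rule isCont_linear_solve[OF S that lin inj[OF that] Wc[OF that] _ 0(2)])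
        (use 0(1) S that continuous_on_eq_continuous_at in auto)
    then show ?case by (simp add: continuous_at_imp_continuous_on)
  next
    case (Suc k)
    note sol = Suc.prems(2)
    \<comment> \<open>the right-hand side obtained by differentiating \<open>W X = F\<close> in the direction \<open>u\<close>\<close>
    let ?R = "\<lambda>x u. frechet_derivative F (at x) u
      - (\<Sum>b\<in>Basis. (X x \<bullet> b) *\<^sub>R frechet_derivative (\<lambda>x. W x b) (at x) u)"
    have "\<exists>Z. (X has_derivative Z) (at x) \<and> (\<forall>u. W x (Z u) = ?R x u)" if x: "x \<in> S" for x
    proof -
      have "((\<lambda>y. F y - (\<Sum>b\<in>Basis. (X x \<bullet> b) *\<^sub>R W y b)) has_derivative ?R x) (at x)"
        by (intro has_derivative_diff has_derivative_sum bounded_linear.has_derivative[OF bounded_linear_scaleR_right]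
            Wd[OF x] Ck_on_open_SucD(1)[OF Suc.prems(1) x])
      then have "((\<lambda>y. F y - W y (X x)) has_derivative ?R x) (at x)"
        by (rule has_derivative_transform_within_open[OF _ S x])
          (simp add: linear_eq_sum_Basis[OF lin, of _ "X x", symmetric])
      from has_derivative_linear_solve[OF S x lin inj[OF x] Wc[OF x] sol this]
      obtain Z where "(X has_derivative Z) (at x)" "\<And>u. W x (Z u) = ?R x u" by blast
      then show ?thesis by blast
    qed
    then have "\<forall>x\<in>S. \<exists>Z. (X has_derivative Z) (at x) \<and> (\<forall>u. W x (Z u) = ?R x u)" by blast
    from bchoice[OF this] obtain Z where Z: "\<And>x. x \<in> S \<Longrightarrow> (X has_derivative Z x) (at x)"
      "\<And>x u. x \<in> S \<Longrightarrow> W x (Z x u) = ?R x u" by blast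
    have X: "Ck_on_open k S X" using Suc by (blast intro: Ck_on_open_pred)
    have "Ck_on_open k S (\<lambda>x. Z x u)" for u
    proof (rule Suc.IH)
      show "Ck_on_open k S (\<lambda>x. ?R x u)"
        by (intro Ck_on_open_diff Ck_on_open_sum S Ck_on_open_SucD(2)[OF Suc.prems(1)]
            Ck_on_open_bilinear[OF bounded_bilinear_scaleR]
            Ck_on_open_linear[OF bounded_linear_inner_left S X]
            smooth_on_open_imp_Ck[OF smooth_on_frechet_derivative[OF W S] S])
    qed (use Z in auto)
    with S Z(1) show ?case by (rule Ck_on_open_SucI)
  qed
  then show ?thesis
    using smooth_on_open_imp_Ck[OF F S] sol by (blast intro: Ck_imp_smooth_on S)
qed

section \<open>Integrals depending on parameters\<close>

lemma Ck_on_open_integral: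
  fixes H :: "'d::euclidean_space \<times> real \<Rightarrow> 'c::euclidean_space"
  assumes "open N" "Ck_on_open k N H" "open B" "convex B" "B \<times> {a..b} \<subseteq> N"
  shows "Ck_on_open k B (\<lambda>u. integral {a..b} (\<lambda>t. H (u, t)))"
  using assms
proof (induction k arbitrary: H)
  case 0
  have "continuous_on B (\<lambda>u. integral (cbox a b) (\<lambda>t. H (u, t)))"
    by (rule integral_continuous_on_param) (use 0 continuous_on_subset in auto)
  then show ?case by simp
next
  case (Suc k)
  let ?D = "\<lambda>u t v. frechet_derivative H (at (u, t)) (v, 0)"
  have D: "((\<lambda>u. H (u, t)) has_derivative ?D u t) (at u)" if "u \<in> B" "t \<in> {a..b}" for u t
  proof -
    have "(u, t) \<in> N" using that Suc.prems by auto
    note dH = Ck_on_open_SucD(1)[OF Suc.prems(2) this]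
    have "((\<lambda>u. (u, t)) has_derivative (\<lambda>v. (v, 0))) (at u)"
      by (intro derivative_eq_intros) auto
    from has_derivative_compose[OF this dH] show ?thesis .
  qed
  have bl: "bounded_linear (?D u t)" if "u \<in> B" "t \<in> {a..b}" for u t
    using D[OF that] by (rule has_derivative_bounded_linear)
  have c: "continuous_on (B \<times> cbox a b) (\<lambda>(u, t). Blinfun (?D u t))"
  proof (rule continuous_on_blinfun_componentwise)
    fix v :: 'd
    have "continuous_on N (\<lambda>x. frechet_derivative H (at x) (v, 0))"
      using Ck_on_open_SucD(2)[OF Suc.prems(2), of "(v, 0)"]
      by (cases k) (auto intro!: continuous_at_imp_continuous_on differentiable_imp_continuous_within)
    then have "continuous_on (B \<times> {a..b}) (\<lambda>x. frechet_derivative H (at x) (v, 0))"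
      by (rule continuous_on_subset[OF _ Suc.prems(5)])
    then show "continuous_on (B \<times> cbox a b) (\<lambda>x. blinfun_apply (case x of (u, t) \<Rightarrow> Blinfun (?D u t)) v)"
      by (rule continuous_on_cong[THEN iffD1, rotated 2]) (auto simp: bounded_linear_Blinfun_apply bl)
  qed
  have cH: "continuous_on N H"
    using Ck_on_open_SucD(1)[OF Suc.prems(2)]
    by (auto intro!: continuous_at_imp_continuous_on has_derivative_continuous)
  have ch: "continuous_on (cbox a b) (\<lambda>t. H (u, t))" if "u \<in> B" for u
    by (rule continuous_on_compose2[OF cH]) (use Suc.prems(5) that in \<open>auto intro!: continuous_intros\<close>)
  have L: "((\<lambda>u. integral {a..b} (\<lambda>t. H (u, t))) has_derivative (\<lambda>v. integral {a..b} (\<lambda>t. ?D u t v))) (at u)"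
    if u: "u \<in> B" for u
  proof -
    have "((\<lambda>u. integral (cbox a b) (\<lambda>t. H (u, t))) has_derivative
        integral (cbox a b) (\<lambda>t. Blinfun (?D u t))) (at u within B)"
    proof (rule leibniz_rule[OF _ integrable_continuous[OF ch] c u \<open>convex B\<close>])
      fix x t assume "x \<in> B" "t \<in> cbox a b"
      then show "((\<lambda>u. H (u, t)) has_derivative blinfun_apply (Blinfun (?D x t))) (at x within B)"
        using D[of x t] bl[of x t] by (simp add: bounded_linear_Blinfun_apply has_derivative_at_withinI)
    qed
    then have "((\<lambda>u. integral {a..b} (\<lambda>t. H (u, t))) has_derivative
        blinfun_apply (integral {a..b} (\<lambda>t. Blinfun (?D u t)))) (at u)"
      by (simp only: at_within_open[OF u Suc.prems(3)] cbox_interval)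
    moreover have "blinfun_apply (integral {a..b} (\<lambda>t. Blinfun (?D u t))) v = integral {a..b} (\<lambda>t. ?D u t v)" for v
    proof -
      have "continuous_on (cbox a b) (\<lambda>t. Blinfun (?D u t))"
        by (rule continuous_on_compose2[OF c, of _ "\<lambda>t. (u, t)", simplified])
          (use u in \<open>auto intro!: continuous_intros\<close>)
      then have "(\<lambda>t. Blinfun (?D u t)) integrable_on {a..b}"
        using integrable_continuous by fastforce
      then have "blinfun_apply (integral {a..b} (\<lambda>t. Blinfun (?D u t))) v
          = integral {a..b} (\<lambda>t. blinfun_apply (Blinfun (?D u t)) v)"
        by (rule blinfun_apply_integral)
      also have "\<dots> = integral {a..b} (\<lambda>t. ?D u t v)"
        by (rule integral_cong) (simp add: bounded_linear_Blinfun_apply bl u)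
      finally show ?thesis .
    qed
    ultimately show ?thesis by (simp add: has_derivative_eq_rhs ext)
  qed
  show ?case
  proof (rule Ck_on_open_SucI[OF \<open>open B\<close> L])
    show "Ck_on_open k B (\<lambda>x. integral {a..b} (\<lambda>t. ?D x t v))" for v
      by (rule Suc.IH[where H = "\<lambda>x. frechet_derivative H (at x) (v, 0)", OF Suc.prems(1)
            Ck_on_open_SucD(2)[OF Suc.prems(2)] Suc.prems(3-5)])
  qed
qed

text \<open>The function \<open>h\<close> is only known to have smooth extensions near each point of \<open>U \<times> [a,b]\<close>. On a
  sufficiently short interval around \<open>t\<close> a single extension serves all \<open>u\<close> near \<open>u\<^sub>0\<close>, and it may be
  differentiated under the integral. It remains to split \<open>[a,b]\<close> into such intervals, by bisection,
  and to add up the partial integrals.\<close>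
lemma smooth_on_integral:
  fixes h :: "'d::euclidean_space \<Rightarrow> real \<Rightarrow> 'c::euclidean_space"
  assumes "a \<le> b" and h: "smooth_on (U \<times> {a..b}) (\<lambda>(u, t). h u t)"
  shows "smooth_on U (\<lambda>u. integral {a..b} (h u))"
proof (rule smooth_onI)
  fix u0 assume u0: "u0 \<in> U"
  have int: "h u integrable_on {a'..b'}" if "a \<le> a'" "b' \<le> b" "u \<in> U" for u a' b'
  proof -
    have "continuous_on {a'..b'} (\<lambda>t. h u t)"
      by (rule continuous_on_compose2[OF smooth_on_imp_continuous_on[OF h], of _ "\<lambda>t. (u, t)", simplified])
        (use that in \<open>auto intro!: continuous_intros\<close>)
    then show ?thesis by (rule integrable_continuous_interval)
  qed
  define P where "P a' b' \<longleftrightarrow> (a \<le> a' \<longrightarrow> a' \<le> b' \<longrightarrow> b' \<le> b \<longrightarrow>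
    (\<exists>N I. open N \<and> u0 \<in> N \<and> (\<forall>k. Ck_on_open k N I) \<and> (\<forall>u\<in>N \<inter> U. I u = integral {a'..b'} (h u))))" for a' b'
  have "P a b"
    using \<open>a \<le> b\<close>
  proof (induction rule: Bolzano)
    case (trans p q r)
    show ?case
      unfolding P_def
    proof (intro impI)
      assume r: "a \<le> p" "p \<le> r" "r \<le> b"
      obtain N I where I: "open N" "u0 \<in> N" "\<And>k. Ck_on_open k N I" "\<And>u. u \<in> N \<inter> U \<Longrightarrow> I u = integral {p..q} (h u)"
        using trans r unfolding P_def by (metis order_trans)
      obtain M J where J: "open M" "u0 \<in> M" "\<And>k. Ck_on_open k M J" "\<And>u. u \<in> M \<inter> U \<Longrightarrow> J u = integral {q..r} (h u)"
        using trans r unfolding P_def by (metis order_trans)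
      have "I u + J u = integral {p..r} (h u)" if "u \<in> N \<inter> M \<inter> U" for u
        using I(4)[of u] J(4)[of u] that r trans Henstock_Kurzweil_Integration.integral_combine[OF trans(3,4) int]
        by auto
      then show "\<exists>N I. open N \<and> u0 \<in> N \<and> (\<forall>k. Ck_on_open k N I) \<and> (\<forall>u\<in>N \<inter> U. I u = integral {p..r} (h u))"
        using I J Ck_on_open_subset[OF I(3), of "N \<inter> M"] Ck_on_open_subset[OF J(3), of "N \<inter> M"]
        by (intro exI[of _ "N \<inter> M"] exI[of _ "\<lambda>u. I u + J u"]) (auto intro!: Ck_on_open_add)
    qed
  next
    case (local t)
    obtain N H where H: "open N" "(u0, t) \<in> N" "\<And>k. Ck_on_open k N H"
      "\<And>y. y \<in> N \<Longrightarrow> y \<in> U \<times> {a..b} \<Longrightarrow> H y = (case y of (u, t) \<Rightarrow> h u t)"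
      using smooth_onE[OF h, of "(u0, t)"] u0 local by (metis SigmaI atLeastAtMost_iff)
    obtain B T where BT: "open B" "open T" "u0 \<in> B" "t \<in> T" "B \<times> T \<subseteq> N"
      using H(1,2) by (metis open_prod_elim mem_Sigma_iff)
    obtain e where e: "e > 0" "ball u0 e \<subseteq> B" using BT by (meson open_contains_ball)
    obtain d where d: "d > 0" "ball t d \<subseteq> T" using BT by (meson open_contains_ball)
    have "P p q" if pq: "p \<le> t" "t \<le> q" "q - p < d" for p q
      unfolding P_def
    proof (intro impI)
      assume ab: "a \<le> p" "p \<le> q" "q \<le> b"
      have T: "{p..q} \<subseteq> T" using d pq by (auto simp: dist_real_def subset_iff)
      then have sub: "ball u0 e \<times> {p..q} \<subseteq> N" using BT e by blast
      have "Ck_on_open k (ball u0 e) (\<lambda>u. integral {p..q} (\<lambda>t. H (u, t)))" for k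
        by (rule Ck_on_open_integral[OF H(1,3) _ _ sub]) auto
      moreover have "integral {p..q} (\<lambda>t. H (u, t)) = integral {p..q} (h u)" if "u \<in> ball u0 e \<inter> U" for u
      proof (rule integral_cong)
        fix s assume s: "s \<in> {p..q}"
        with that sub have "(u, s) \<in> N" by blast
        with H(4)[of "(u, s)"] that s ab show "H (u, s) = h u s" by simp
      qed
      ultimately show "\<exists>N I. open N \<and> u0 \<in> N \<and> (\<forall>k. Ck_on_open k N I) \<and> (\<forall>u\<in>N \<inter> U. I u = integral {p..q} (h u))"
        using e by (intro exI[of _ "ball u0 e"] exI[of _ "\<lambda>u. integral {p..q} (\<lambda>t. H (u, t))"]) auto
    qed
    then show ?case using d(1) by blast
  qed
  then show "\<exists>N H. open N \<and> u0 \<in> N \<and> (\<forall>k. Ck_on_open k N H) \<and> (\<forall>u\<in>N \<inter> U. H u = integral {a..b} (h u))"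
    using \<open>a \<le> b\<close> by (simp add: P_def)
qed

section \<open>Bump functions\<close>

text \<open>The factors \<open>1 / x ^ n\<close> make the family closed under differentiation up to linear combinations,
  which turns smoothness of \<open>exp (- (1 / x))\<close> at 0 into an induction.\<close>
definition flat_exp :: "nat \<Rightarrow> real \<Rightarrow> real" where
  "flat_exp n x = (if x \<le> 0 then 0 else exp (- (1 / x)) / x ^ n)"

lemma flat_exp_tendsto_0: "(flat_exp n \<longlongrightarrow> 0) (at 0)"
proof -
  have "((\<lambda>y. y ^ n / exp y) \<longlongrightarrow> 0) (at_top :: real filter)" by (rule tendsto_power_div_exp_0)
  then have "((\<lambda>x::real. inverse x ^ n / exp (inverse x)) \<longlongrightarrow> 0) (at_right 0)"
    by (rule filterlim_compose[OF _ filterlim_inverse_at_top_right])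
  moreover have "\<forall>\<^sub>F x in at_right 0. inverse x ^ n / exp (inverse x) = flat_exp n x"
    by (auto simp: eventually_at_filter flat_exp_def exp_minus divide_simps)
  ultimately have "(flat_exp n \<longlongrightarrow> 0) (at_right 0)" by (rule Lim_transform_eventually)
  moreover have "(flat_exp n \<longlongrightarrow> 0) (at_left 0)"
    by (rule tendsto_eventually) (auto simp: eventually_at_filter flat_exp_def)
  ultimately show ?thesis by (simp add: filterlim_at_split)
qed

lemma flat_exp_has_derivative:
  "(flat_exp n has_real_derivative flat_exp (n + 2) x - real n * flat_exp (n + 1) x) (at x)"
proof -
  consider "x < 0" | "x = 0" | "x > 0" by linarith
  then show ?thesis
  proof cases
    case 1
    have "((\<lambda>x. 0) has_real_derivative 0) (at x)" by simp
    then have "(flat_exp n has_real_derivative 0) (at x)"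
      by (rule has_field_derivative_transform_within_open[of _ _ _ "{..<0}"]) (use 1 in \<open>auto simp: flat_exp_def\<close>)
    with 1 show ?thesis by (simp add: flat_exp_def)
  next
    case 2
    have "((\<lambda>h. (flat_exp n h - flat_exp n 0) / (h - 0)) \<longlongrightarrow> 0) (at 0)"
      using flat_exp_tendsto_0[of "n + 1"] by (rule Lim_transform_eventually)
        (auto simp: eventually_at_filter flat_exp_def field_simps)
    with 2 show ?thesis by (simp add: has_field_derivative_iff flat_exp_def)
  next
    case 3
    have "((\<lambda>x. exp (- (1 / x)) / x ^ n) has_real_derivative
        flat_exp (n + 2) x - real n * flat_exp (n + 1) x) (at x)"
    proof (cases n)
      case 0
      then show ?thesis using 3
        by (auto intro!: derivative_eq_intros simp: flat_exp_def power2_eq_square)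
    next
      case (Suc m)
      have "((\<lambda>x. exp (- (1 / x)) / x ^ n) has_real_derivative
          ((1 / x\<^sup>2 * exp (- (1 / x))) * x ^ n - exp (- (1 / x)) * (real n * x ^ (n - 1))) / (x ^ n * x ^ n)) (at x)"
        using 3 by (auto intro!: derivative_eq_intros simp: power2_eq_square)
      also have "((1 / x\<^sup>2 * exp (- (1 / x))) * x ^ n - exp (- (1 / x)) * (real n * x ^ (n - 1))) / (x ^ n * x ^ n)
          = flat_exp (n + 2) x - real n * flat_exp (n + 1) x"
        using 3 by (simp add: flat_exp_def Suc power2_eq_square divide_simps) (simp add: algebra_simps)
      finally show ?thesis .
    qed
    then show ?thesis
      by (rule has_field_derivative_transform_within_open[of _ _ _ "{0<..}"]) (use 3 in \<open>auto simp: flat_exp_def\<close>)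
  qed
qed

lemma Ck_on_open_flat_exp: "Ck_on_open k UNIV (flat_exp n)"
proof (induction k arbitrary: n)
  case 0
  have "isCont (flat_exp n) x" for x using flat_exp_has_derivative by (rule DERIV_isCont)
  then show ?case by (simp add: continuous_at_imp_continuous_on)
next
  case (Suc k)
  show ?case
  proof (rule Ck_on_open_SucI)
    show "(flat_exp n has_derivative (\<lambda>u. (flat_exp (n + 2) x - real n * flat_exp (n + 1) x) * u)) (at x)" for x
      using flat_exp_has_derivative[of n x] by (simp add: has_field_derivative_def)
    show "Ck_on_open k UNIV (\<lambda>x. (flat_exp (n + 2) x - real n * flat_exp (n + 1) x) * u)" for u
      by (intro Ck_on_open_bilinear[OF bounded_bilinear_mult] Ck_on_open_diff Ck_on_open_const Suc.IH open_UNIV)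
  qed simp
qed

definition bump :: "real \<Rightarrow> real \<Rightarrow> real \<Rightarrow> real" where
  "bump a b t = flat_exp 0 (t - a) * flat_exp 0 (b - t)"

lemma smooth_on_bump: "smooth_on S (bump a b)"
proof -
  have f: "smooth_on UNIV (flat_exp 0)" by (rule Ck_imp_smooth_on[OF open_UNIV Ck_on_open_flat_exp])
  have 1: "smooth_on S (\<lambda>t. t + (- a))" "smooth_on S (\<lambda>t. b + - t)"
    by (intro smooth_on_add smooth_on_const smooth_on_id smooth_on_linear_map bounded_linear_minus bounded_linear_ident)+
  show ?thesis
    using smooth_on_mult[OF smooth_on_compose[OF 1(1) f] smooth_on_compose[OF 1(2) f]]
    by (simp add: bump_def[abs_def])
qed

lemma bump_nonneg: "bump a b t \<ge> 0" and bump_pos: "a < t \<Longrightarrow> t < b \<Longrightarrow> bump a b t > 0"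
  and bump_outside: "t \<notin> {a<..<b} \<Longrightarrow> bump a b t = 0"
  by (auto simp: bump_def flat_exp_def)

lemma bump_le_1: "bump a b t \<le> 1"
proof -
  have "flat_exp 0 x \<le> 1" "flat_exp 0 x \<ge> 0" for x by (auto simp: flat_exp_def)
  then show ?thesis unfolding bump_def by (simp add: mult_le_one)
qed

text \<open>The fundamental lemma of the calculus of variations. If \<open>q\<close> did not vanish at \<open>t0\<close>, then it would
  keep its sign on a short interval around \<open>t0\<close> (one-sided if \<open>t0\<close> is an end point), and the bump
  function of that interval would detect it.\<close>
lemma bump_integrals_zero_imp_zero:
  fixes q :: "real \<Rightarrow> real"
  assumes T: "open T" "t0 \<in> T" "t0 \<in> {l..r}" "l < r" and q: "continuous_on (T \<inter> {l..r}) q"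
    and zero: "\<And>a b. l \<le> a \<Longrightarrow> a < b \<Longrightarrow> b \<le> r \<Longrightarrow> {a..b} \<subseteq> T \<Longrightarrow>
      integral {a..b} (\<lambda>t. bump a b t * q t) = 0"
  shows "q t0 = 0"
proof (rule ccontr)
  assume nz: "q t0 \<noteq> 0"
  obtain e where e: "e > 0" "ball t0 e \<subseteq> T" using T by (meson open_contains_ball)
  have "continuous (at t0 within T \<inter> {l..r}) q"
    using q T by (simp add: continuous_on_eq_continuous_within)
  then obtain d where d: "d > 0" "\<And>t. t \<in> T \<inter> {l..r} \<Longrightarrow> dist t t0 < d \<Longrightarrow> dist (q t) (q t0) < \<bar>q t0\<bar>"
    unfolding continuous_within_eps_delta using nz by (metis zero_less_abs_iff)
  \<comment> \<open>half of the admissible radius, so that the closed interval still lies in both neighbourhoods\<close>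
  define m where "m = min d e / 2"
  have m: "m > 0" "m < d" "m < e" using d e by (auto simp: m_def)
  define a where "a = max l (t0 - m)"
  define b where "b = min r (t0 + m)"
  have ab: "l \<le> a" "a < b" "b \<le> r" using T m by (auto simp: a_def b_def)
  have near: "t \<in> T \<and> t \<in> {l..r} \<and> q t * q t0 > 0" if "t \<in> {a..b}" for t
  proof -
    have t: "dist t t0 \<le> m" "t \<in> {l..r}" using that by (auto simp: a_def b_def dist_real_def)
    then have "t \<in> T" using e m by (auto simp: subset_iff dist_commute)
    with d(2)[of t] t m have "\<bar>q t - q t0\<bar> < \<bar>q t0\<bar>" by (simp add: dist_real_def)
    then have "q t * q t0 > 0" by (auto simp: zero_less_mult_iff abs_if split: if_splits)
    with t \<open>t \<in> T\<close> show ?thesis by simp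
  qed
  have "{a..b} \<subseteq> T" using near by blast
  with zero ab have z: "integral {a..b} (\<lambda>t. bump a b t * q t) = 0" by blast
  let ?h = "\<lambda>t. bump a b t * q t * q t0"
  have "continuous_on {a..b} q" using q by (rule continuous_on_subset) (use near in auto)
  then have c: "continuous_on {a..b} (\<lambda>t. bump a b t * q t)"
    by (intro continuous_on_mult smooth_on_imp_continuous_on[OF smooth_on_bump])
  then have "((\<lambda>t. bump a b t * q t) has_integral 0) {a..b}"
    using z by (metis integrable_continuous_interval integrable_integral)
  then have "(?h has_integral 0) {a..b}" by (metis has_integral_mult_left mult_zero_left)
  moreover have "continuous_on (cbox a b) ?h"
    using continuous_on_mult_right[OF c, of "q t0"] by simp
  moreover have "0 \<le> ?h t" if "t \<in> cbox a b" for t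
    using near[of t] that bump_nonneg[of a b t] by (simp add: mult.assoc)
  ultimately have "?h ((a + b) / 2) = 0"
    using has_integral_0_cbox_imp_0[of a b ?h "(a + b) / 2"] ab by auto
  moreover have "?h ((a + b) / 2) > 0"
    using near[of "(a + b) / 2"] bump_pos[of a "(a + b) / 2" b] ab by (simp add: mult.assoc)
  ultimately show False by (metis less_irrefl)
qed

section \<open>Charts, tangent vectors and differentials\<close>

locale smooth_manifold =
  fixes A :: "('a::{t2_space,second_countable_topology}, 'e::euclidean_space) chart set"
  assumes atlas: "smooth_atlas A"
begin

lemma chart_around: obtains c where "c \<in> A" "p \<in> chart_dom c"
  using atlas unfolding smooth_atlas_def by blast

lemma chart_homeomorphism:
  "c \<in> A \<Longrightarrow> homeomorphism (chart_dom c) (chart_img c) (chart_map c) (chart_inv c)"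
  using atlas unfolding smooth_atlas_def by blast

lemma open_chart_dom: "c \<in> A \<Longrightarrow> open (chart_dom c)"
  and open_chart_img: "c \<in> A \<Longrightarrow> open (chart_img c)"
  using atlas unfolding smooth_atlas_def by blast+

lemma chart_inv_map: "c \<in> A \<Longrightarrow> p \<in> chart_dom c \<Longrightarrow> chart_inv c (chart_map c p) = p"
  and chart_map_inv: "c \<in> A \<Longrightarrow> x \<in> chart_img c \<Longrightarrow> chart_map c (chart_inv c x) = x"
  using chart_homeomorphism by (auto simp: homeomorphism_def)

lemma chart_map_in: "p \<in> chart_dom c \<Longrightarrow> chart_map c p \<in> chart_img c"
  by (simp add: chart_img_def)

lemma chart_inv_in: "c \<in> A \<Longrightarrow> x \<in> chart_img c \<Longrightarrow> chart_inv c x \<in> chart_dom c"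
  using chart_homeomorphism[of c] unfolding homeomorphism_def by blast

lemma continuous_on_chart_inv: "c \<in> A \<Longrightarrow> continuous_on (chart_img c) (chart_inv c)"
  using chart_homeomorphism by (auto simp: homeomorphism_def)

lemma overlap_eq:
  assumes "c \<in> A"
  shows "chart_map c ` (chart_dom c \<inter> chart_dom c') = {x \<in> chart_img c. chart_inv c x \<in> chart_dom c'}"
  using assms by (force simp: chart_inv_map chart_map_in chart_map_inv chart_inv_in image_iff)

lemma open_overlap:
  assumes "c \<in> A" "c' \<in> A"
  shows "open (chart_map c ` (chart_dom c \<inter> chart_dom c'))"
proof -
  have "open (chart_img c \<inter> chart_inv c -` chart_dom c')"
    by (rule continuous_open_preimage[OF continuous_on_chart_inv]) (use assms open_chart_dom open_chart_img in auto)
  then show ?thesis unfolding overlap_eq[OF assms(1)] by (simp add: vimage_def Int_def)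
qed

lemma smooth_on_transition:
  assumes "c \<in> A" "c' \<in> A"
  shows "smooth_on (chart_map c ` (chart_dom c \<inter> chart_dom c')) (chart_map c' \<circ> chart_inv c)"
  using atlas assms unfolding smooth_atlas_def by blast

lemma transition_has_derivative:
  assumes "c \<in> A" "c' \<in> A" "p \<in> chart_dom c" "p \<in> chart_dom c'"
  shows "((chart_map c' \<circ> chart_inv c) has_derivative transition_deriv c c' p) (at (chart_map c p))"
  unfolding transition_deriv_def
  by (rule smooth_on_open_has_derivative[OF smooth_on_transition open_overlap]) (use assms in auto)

lemma linear_transition_deriv:
  assumes "c \<in> A" "c' \<in> A" "p \<in> chart_dom c" "p \<in> chart_dom c'"
  shows "linear (transition_deriv c c' p)"
  using transition_has_derivative[OF assms] by (rule has_derivative_linear)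

lemma transition_deriv_self:
  assumes "c \<in> A" "p \<in> chart_dom c"
  shows "transition_deriv c c p u = u"
proof -
  have "((\<lambda>x. x) has_derivative transition_deriv c c p) (at (chart_map c p))"
    by (rule has_derivative_transform_within_open[OF transition_has_derivative[OF assms(1,1,2,2)] open_chart_img])
      (use assms in \<open>auto simp: chart_map_in chart_map_inv\<close>)
  from has_derivative_unique[OF this has_derivative_ident] show ?thesis by simp
qed


text \<open>The chain rule for a function on the manifold read in two charts. Both the cocycle property of
  the transition derivatives and the chart independence of the differential are instances.\<close>
lemma has_derivative_change_chart:
  assumes c: "c \<in> A" "c' \<in> A" "p \<in> chart_dom c" "p \<in> chart_dom c'"
    and D: "((\<lambda>x. F (chart_inv c' x)) has_derivative D) (at (chart_map c' p))"
  shows "((\<lambda>x. F (chart_inv c x)) has_derivative (\<lambda>u. D (transition_deriv c c' p u))) (at (chart_map c p))"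
proof -
  have "((\<lambda>x. F (chart_inv c' ((chart_map c' \<circ> chart_inv c) x))) has_derivative
      (\<lambda>u. D (transition_deriv c c' p u))) (at (chart_map c p))"
    by (rule has_derivative_compose[OF transition_has_derivative[OF c]])
      (use D c in \<open>simp add: chart_inv_map\<close>)
  then show ?thesis
    by (rule has_derivative_transform_within_open[OF _ open_overlap[OF c(1,2)]])
      (use c in \<open>auto simp: chart_inv_map\<close>)
qed

text \<open>Apply the change of charts from \<open>c\<close> to \<open>c'\<close> to the coordinate map of \<open>c''\<close>.\<close>
lemma transition_deriv_cocycle:
  assumes "c \<in> A" "c' \<in> A" "c'' \<in> A" "p \<in> chart_dom c" "p \<in> chart_dom c'" "p \<in> chart_dom c''"
  shows "transition_deriv c' c'' p (transition_deriv c c' p u) = transition_deriv c c'' p u"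
proof -
  have "((\<lambda>x. chart_map c'' (chart_inv c' x)) has_derivative transition_deriv c' c'' p) (at (chart_map c' p))"
    using transition_has_derivative[of c' c'' p] assms by (simp add: comp_def)
  from has_derivative_change_chart[OF assms(1,2,4,5) this]
  have "(chart_map c'' \<circ> chart_inv c has_derivative
      (\<lambda>u. transition_deriv c' c'' p (transition_deriv c c' p u))) (at (chart_map c p))"
    by (simp add: comp_def)
  from has_derivative_unique[OF this transition_has_derivative[OF assms(1,3,4,6)]]
  show ?thesis by metis
qed

lemma smooth_on_transition_deriv:
  assumes "c \<in> A" "c' \<in> A"
  shows "smooth_on (chart_map c ` (chart_dom c \<inter> chart_dom c')) (\<lambda>x. transition_deriv c c' (chart_inv c x) u)"
  by (rule smooth_on_cong[OF smooth_on_frechet_derivative[OF smooth_on_transition[OF assms] open_overlap[OF assms], of u]])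
    (use assms in \<open>auto simp: transition_deriv_def chart_inv_map\<close>)


lemma tangent_space_outside: "v \<in> tangent_space A p \<Longrightarrow> \<not> (c \<in> A \<and> p \<in> chart_dom c) \<Longrightarrow> v c = 0"
  unfolding tangent_space_def by blast

lemma tangent_space_transition:
  "v \<in> tangent_space A p \<Longrightarrow> c \<in> A \<Longrightarrow> c' \<in> A \<Longrightarrow> p \<in> chart_dom c \<Longrightarrow> p \<in> chart_dom c' \<Longrightarrow>
    v c' = transition_deriv c c' p (v c)"
  unfolding tangent_space_def by blast

lemma coord_vec_in_tangent_space:
  assumes "c \<in> A" "p \<in> chart_dom c"
  shows "coord_vec A c p u \<in> tangent_space A p"
  using assms by (auto simp: tangent_space_def coord_vec_def transition_deriv_cocycle)

lemma coord_vec_same: "c \<in> A \<Longrightarrow> p \<in> chart_dom c \<Longrightarrow> coord_vec A c p u c = u"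
  by (simp add: coord_vec_def transition_deriv_self)

text \<open>Together with \<open>coord_vec_same\<close> this identifies a tangent space with the model space \<open>'e\<close> through any
  chart; all linear algebra on tangent spaces is done there.\<close>
lemma tangent_eq_coord_vec:
  assumes "v \<in> tangent_space A p" "c \<in> A" "p \<in> chart_dom c"
  shows "coord_vec A c p (v c) = v"
proof
  show "coord_vec A c p (v c) c' = v c'" for c'
    using tangent_space_outside[OF assms(1), of c'] tangent_space_transition[OF assms(1,2) _ assms(3), of c']
    by (auto simp: coord_vec_def)
qed

lemma tangent_space_tadd:
  assumes "v \<in> tangent_space A p" "w \<in> tangent_space A p"
  shows "tadd v w \<in> tangent_space A p"
proof -
  have "(v c + w c) = 0" if "\<not> (c \<in> A \<and> p \<in> chart_dom c)" for c
    using that assms[THEN tangent_space_outside, of c] by simp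
  moreover have "v c' + w c' = transition_deriv c c' p (v c + w c)"
    if "c \<in> A" "c' \<in> A" "p \<in> chart_dom c" "p \<in> chart_dom c'" for c c'
    using that assms[THEN tangent_space_transition, of c c'] by (simp add: linear_add[OF linear_transition_deriv])
  ultimately show ?thesis unfolding tangent_space_def tadd_def by blast
qed

lemma tangent_space_tscale:
  assumes "v \<in> tangent_space A p"
  shows "tscale r v \<in> tangent_space A p"
proof -
  have "r *\<^sub>R v c = 0" if "\<not> (c \<in> A \<and> p \<in> chart_dom c)" for c
    using that assms[THEN tangent_space_outside, of c] by simp
  moreover have "r *\<^sub>R v c' = transition_deriv c c' p (r *\<^sub>R v c)"
    if "c \<in> A" "c' \<in> A" "p \<in> chart_dom c" "p \<in> chart_dom c'" for c c'
    using that assms[THEN tangent_space_transition, of c c'] by (simp add: linear_scale[OF linear_transition_deriv])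
  ultimately show ?thesis unfolding tangent_space_def tscale_def by blast
qed

lemma tangent_space_zero: "(\<lambda>c. 0) \<in> tangent_space A p"
  by (auto simp: tangent_space_def linear_0[OF linear_transition_deriv])

lemma tsum_lessThan_Suc: "tsum V {..<Suc k} = tadd (tsum V {..<k}) (V k)"
  by (simp add: tsum_def tadd_def)

lemma tangent_space_tsum:
  fixes k :: nat
  shows "(\<And>i. i < k \<Longrightarrow> V i \<in> tangent_space A p) \<Longrightarrow> tsum V {..<k} \<in> tangent_space A p"
proof (induction k)
  case 0
  show ?case using tangent_space_zero by (simp add: tsum_def)
next
  case (Suc k)
  then show ?case by (auto simp: tsum_lessThan_Suc intro: tangent_space_tadd)
qed

lemma coord_vec_add:
  assumes "c \<in> A" "p \<in> chart_dom c"
  shows "coord_vec A c p (u + v) = tadd (coord_vec A c p u) (coord_vec A c p v)"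
  using assms by (auto simp: coord_vec_def tadd_def linear_add[OF linear_transition_deriv])

lemma coord_vec_scale:
  assumes "c \<in> A" "p \<in> chart_dom c"
  shows "coord_vec A c p (r *\<^sub>R u) = tscale r (coord_vec A c p u)"
  using assms by (auto simp: coord_vec_def tscale_def linear_scale[OF linear_transition_deriv])


lemma smooth_on_C_inf: "f \<in> C_inf A \<Longrightarrow> c \<in> A \<Longrightarrow> smooth_on (chart_img c) (\<lambda>x. f (chart_inv c x))"
  by (simp add: C_inf_def comp_def)

lemma C_inf_has_derivative:
  assumes "f \<in> C_inf A" "c \<in> A" "x \<in> chart_img c"
  shows "((\<lambda>x. f (chart_inv c x)) has_derivative frechet_derivative (\<lambda>x. f (chart_inv c x)) (at x)) (at x)"
  by (rule smooth_on_open_has_derivative[OF smooth_on_C_inf open_chart_img]) (use assms in auto)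

text \<open>The definition of \<open>differential\<close> computes in an unspecified chart around \<open>p\<close>. Chart independence
  makes any chart available.\<close>
lemma differential_in_chart:
  assumes f: "f \<in> C_inf A" and c: "c \<in> A" "p \<in> chart_dom c" and v: "v \<in> tangent_space A p"
  shows "differential A f p v = frechet_derivative (\<lambda>x. f (chart_inv c x)) (at (chart_map c p)) (v c)"
proof -
  define c0 where "c0 = (SOME c. c \<in> A \<and> p \<in> chart_dom c)"
  have c0: "c0 \<in> A" "p \<in> chart_dom c0" unfolding c0_def using someI[of "\<lambda>c. c \<in> A \<and> p \<in> chart_dom c"] c by auto
  have "frechet_derivative (\<lambda>x. f (chart_inv c x)) (at (chart_map c p)) (v c)
     = frechet_derivative (\<lambda>x. f (chart_inv c0 x)) (at (chart_map c0 p)) (transition_deriv c c0 p (v c))"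
    using frechet_derivative_at[OF has_derivative_change_chart[OF c(1) c0(1) c(2) c0(2)
          C_inf_has_derivative[OF f c0(1) chart_map_in[OF c0(2)]]]] by metis
  then show ?thesis
    using tangent_space_transition[OF v c(1) c0(1) c(2) c0(2)]
    by (simp add: differential_def Let_def comp_def flip: c0_def)
qed

lemma linear_chart_derivative:
  assumes "f \<in> C_inf A" "c \<in> A" "p \<in> chart_dom c"
  shows "linear (frechet_derivative (\<lambda>x. f (chart_inv c x)) (at (chart_map c p)))"
  using C_inf_has_derivative[OF assms(1,2) chart_map_in[OF assms(3)]] by (rule has_derivative_linear)

lemma C_inf_const: "(\<lambda>p. a) \<in> C_inf A"
  by (simp add: C_inf_def comp_def smooth_on_const)

lemma C_inf_add: "f \<in> C_inf A \<Longrightarrow> g \<in> C_inf A \<Longrightarrow> (\<lambda>p. f p + g p) \<in> C_inf A"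
  by (auto simp: C_inf_def comp_def intro: smooth_on_add)

lemma C_inf_scale: "f \<in> C_inf A \<Longrightarrow> (\<lambda>p. r * f p) \<in> C_inf A"
  by (auto simp: C_inf_def comp_def intro: smooth_on_mult smooth_on_const)

lemma differential_const: "differential A (\<lambda>p. a) p v = 0"
  by (simp add: differential_def Let_def comp_def)

lemma differential_tscale:
  assumes "f \<in> C_inf A" "v \<in> tangent_space A p"
  shows "differential A f p (tscale r v) = r * differential A f p v"
proof -
  obtain c where c: "c \<in> A" "p \<in> chart_dom c" by (rule chart_around)
  show ?thesis
    using differential_in_chart[OF assms(1) c assms(2)]
      differential_in_chart[OF assms(1) c tangent_space_tscale[OF assms(2)], of r]
    by (simp add: tscale_def linear_scale[OF linear_chart_derivative[OF assms(1) c]])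
qed

lemma differential_add:
  assumes "f \<in> C_inf A" "g \<in> C_inf A" "v \<in> tangent_space A p"
  shows "differential A (\<lambda>p. f p + g p) p v = differential A f p v + differential A g p v"
proof -
  obtain c where c: "c \<in> A" "p \<in> chart_dom c" by (rule chart_around)
  have d: "((\<lambda>x. f (chart_inv c x) + g (chart_inv c x)) has_derivative
    (\<lambda>u. frechet_derivative (\<lambda>x. f (chart_inv c x)) (at (chart_map c p)) u +
     frechet_derivative (\<lambda>x. g (chart_inv c x)) (at (chart_map c p)) u)) (at (chart_map c p))"
    by (intro has_derivative_add C_inf_has_derivative assms c chart_map_in)
  show ?thesis
    unfolding differential_in_chart[OF C_inf_add[OF assms(1,2)] c assms(3)]
      differential_in_chart[OF assms(1) c assms(3)] differential_in_chart[OF assms(2) c assms(3)]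
    by (simp flip: frechet_derivative_at[OF d])
qed

lemma differential_scale:
  assumes "f \<in> C_inf A" "v \<in> tangent_space A p"
  shows "differential A (\<lambda>p. r * f p) p v = r * differential A f p v"
proof -
  obtain c where c: "c \<in> A" "p \<in> chart_dom c" by (rule chart_around)
  have d: "((\<lambda>x. r * f (chart_inv c x)) has_derivative
    (\<lambda>u. r * frechet_derivative (\<lambda>x. f (chart_inv c x)) (at (chart_map c p)) u)) (at (chart_map c p))"
    by (intro has_derivative_mult_right C_inf_has_derivative assms c chart_map_in)
  show ?thesis
    unfolding differential_in_chart[OF C_inf_scale[OF assms(1)] c assms(2)]
      differential_in_chart[OF assms(1) c assms(2)]
    by (simp flip: frechet_derivative_at[OF d])
qed


lemma smooth_into_chart:
  "smooth_into A S h \<Longrightarrow> c \<in> A \<Longrightarrow> smooth_on {x \<in> S. h x \<in> chart_dom c} (\<lambda>x. chart_map c (h x))"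
  by (simp add: smooth_into_def comp_def)

text \<open>The preimages of chart domains under a continuous map are relatively open, which reduces
  smoothness along \<open>h\<close> to computations in one chart at a time.\<close>
lemma smooth_on_chartwise:
  assumes h: "continuous_on S h"
    and q: "\<And>c. c \<in> A \<Longrightarrow> smooth_on {x \<in> S. h x \<in> chart_dom c} q"
  shows "smooth_on S q"
proof (rule smooth_on_local)
  fix x assume x: "x \<in> S"
  obtain c where c: "c \<in> A" "h x \<in> chart_dom c" by (rule chart_around)
  obtain T where T: "open T" "T \<inter> S = h -` chart_dom c \<inter> S"
    using h open_chart_dom[OF c(1)] unfolding continuous_on_open_invariant by blast
  have "S \<inter> T \<subseteq> {x \<in> S. h x \<in> chart_dom c}" using T by blast
  then show "\<exists>N. open N \<and> x \<in> N \<and> smooth_on (S \<inter> N) q"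
    using smooth_on_subset[OF q[OF c(1)]] T c x by blast
qed

lemma smooth_on_C_inf_compose:
  assumes f: "f \<in> C_inf A" and h: "smooth_into A S h"
  shows "smooth_on S (\<lambda>x. f (h x))"
proof (rule smooth_on_chartwise[of S h])
  show "continuous_on S h" using h by (simp add: smooth_into_def)
  fix c assume c: "c \<in> A"
  have "smooth_on {x \<in> S. h x \<in> chart_dom c} (\<lambda>x. f (chart_inv c (chart_map c (h x))))"
    by (rule smooth_on_compose[OF smooth_into_chart[OF h c] smooth_on_C_inf[OF f c]]) (simp add: chart_map_in)
  then show "smooth_on {x \<in> S. h x \<in> chart_dom c} (\<lambda>x. f (h x))"
    by (rule smooth_on_cong) (simp add: chart_inv_map c)
qed

lemma smooth_along_vector_field:
  assumes X: "X \<in> vector_fields A" and h: "smooth_into A S h"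
  shows "smooth_along A S h (\<lambda>x. X (h x))"
  unfolding smooth_along_def
proof
  fix c assume c: "c \<in> A"
  have "smooth_on (chart_img c) (\<lambda>x. X (chart_inv c x) c)" using X c by (simp add: vector_fields_def)
  from smooth_on_compose[OF smooth_into_chart[OF h c] this]
  have "smooth_on {x \<in> S. h x \<in> chart_dom c} (\<lambda>x. X (chart_inv c (chart_map c (h x))) c)"
    by (simp add: chart_map_in)
  then show "smooth_on {x \<in> S. h x \<in> chart_dom c} (\<lambda>x. X (h x) c)"
    by (rule smooth_on_cong) (simp add: chart_inv_map c)
qed

lemma smooth_on_differential:
  assumes f: "f \<in> C_inf A" and h: "smooth_into A S h" and V: "smooth_along A S h V"
    and VT: "\<And>x. x \<in> S \<Longrightarrow> V x \<in> tangent_space A (h x)"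
  shows "smooth_on S (\<lambda>x. differential A f (h x) (V x))"
proof (rule smooth_on_chartwise[of S h])
  show "continuous_on S h" using h by (simp add: smooth_into_def)
  fix c assume c: "c \<in> A"
  let ?S = "{x \<in> S. h x \<in> chart_dom c}"
  let ?F = "\<lambda>x. f (chart_inv c x)"
  have Vc: "smooth_on ?S (\<lambda>x. V x c)" using V c by (simp add: smooth_along_def)
  have "smooth_on ?S (\<lambda>x. \<Sum>b\<in>Basis. (V x c \<bullet> b) *\<^sub>R frechet_derivative ?F (at (chart_map c (h x))) b)"
    by (intro smooth_on_sum smooth_on_scaleR smooth_on_inner Vc smooth_on_const
        smooth_on_compose[OF smooth_into_chart[OF h c] smooth_on_frechet_derivative[OF smooth_on_C_inf[OF f c] open_chart_img[OF c]]])
      (simp add: chart_map_in)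
  then show "smooth_on ?S (\<lambda>x. differential A f (h x) (V x))"
  proof (rule smooth_on_cong)
    fix x assume x: "x \<in> ?S"
    then have hx: "h x \<in> chart_dom c" and "x \<in> S" by auto
    show "differential A f (h x) (V x) =
      (\<Sum>b\<in>Basis. (V x c \<bullet> b) *\<^sub>R frechet_derivative ?F (at (chart_map c (h x))) b)"
      unfolding differential_in_chart[OF f c hx VT[OF \<open>x \<in> S\<close>]]
      by (rule linear_eq_sum_Basis[OF linear_chart_derivative[OF f c hx]])
  qed
qed

end

section \<open>Hamiltonian vector fields on the manifold\<close>

locale almost_symplectic = smooth_manifold A
  for A :: "('a::{t2_space,second_countable_topology}, 'e::euclidean_space) chart set" +
  fixes \<omega> :: "('a, 'e) form2"
  assumes two_form: "two_form A \<omega>" and nondegenerate: "nondegenerate_form2 A \<omega>"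
begin

lemma form_antisym: "v \<in> tangent_space A p \<Longrightarrow> w \<in> tangent_space A p \<Longrightarrow> \<omega> p v w = - \<omega> p w v"
  and form_scale_left: "v \<in> tangent_space A p \<Longrightarrow> w \<in> tangent_space A p \<Longrightarrow> \<omega> p (tscale r v) w = r * \<omega> p v w"
  and form_add_left: "v \<in> tangent_space A p \<Longrightarrow> w \<in> tangent_space A p \<Longrightarrow> v' \<in> tangent_space A p \<Longrightarrow>
    \<omega> p (tadd v v') w = \<omega> p v w + \<omega> p v' w"
  using two_form unfolding two_form_def by blast+

lemma form_zero_left: "w \<in> tangent_space A p \<Longrightarrow> \<omega> p (\<lambda>c. 0) w = 0"
  using form_scale_left[of "\<lambda>c. 0" p w 0] tangent_space_zero by (simp add: tscale_def)

lemma form_tsum_left: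
  fixes k :: nat
  assumes "w \<in> tangent_space A p"
  shows "(\<And>i. i < k \<Longrightarrow> V i \<in> tangent_space A p) \<Longrightarrow> \<omega> p (tsum V {..<k}) w = (\<Sum>i<k. \<omega> p (V i) w)"
proof (induction k)
  case 0
  show ?case using form_zero_left[OF assms] by (simp add: tsum_def)
next
  case (Suc k)
  then show ?case
    by (simp add: tsum_lessThan_Suc form_add_left[OF tangent_space_tsum assms])
qed

lemma form_scale_right: "v \<in> tangent_space A p \<Longrightarrow> w \<in> tangent_space A p \<Longrightarrow> \<omega> p w (tscale r v) = r * \<omega> p w v"
  using form_antisym[of w p "tscale r v"] form_antisym[of w p v]
  by (simp add: tangent_space_tscale form_scale_left)

lemma form_add_right: "v \<in> tangent_space A p \<Longrightarrow> w \<in> tangent_space A p \<Longrightarrow> v' \<in> tangent_space A p \<Longrightarrow>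
    \<omega> p w (tadd v v') = \<omega> p w v + \<omega> p w v'"
  using form_antisym[of w p "tadd v v'"] form_antisym[of w p v] form_antisym[of w p v']
  by (simp add: tangent_space_tadd form_add_left)

text \<open>Nondegeneracy, used as the injectivity of \<open>v \<mapsto> \<omega> p v\<close>.\<close>
lemma form_eqI:
  assumes "v \<in> tangent_space A p" "v' \<in> tangent_space A p"
    and eq: "\<And>w. w \<in> tangent_space A p \<Longrightarrow> \<omega> p v w = \<omega> p v' w"
  shows "v = v'"
proof -
  let ?d = "tadd v (tscale (- 1) v')"
  have "?d \<in> tangent_space A p" using assms by (intro tangent_space_tadd tangent_space_tscale)
  moreover have "\<omega> p ?d w = 0" if "w \<in> tangent_space A p" for w
    using assms that by (simp add: form_add_left form_scale_left tangent_space_tscale)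
  ultimately have "?d = (\<lambda>c. 0)" using nondegenerate unfolding nondegenerate_form2_def by blast
  then show ?thesis by (auto simp: tadd_def tscale_def fun_eq_iff)
qed

lemma linear_form_left:
  assumes "c \<in> A" "p \<in> chart_dom c" "w \<in> tangent_space A p"
  shows "linear (\<lambda>u. \<omega> p (coord_vec A c p u) w)"
  by (rule linearI) (simp_all add: assms coord_vec_add coord_vec_scale form_add_left form_scale_left
      coord_vec_in_tangent_space)

lemma linear_form_right:
  assumes "c \<in> A" "p \<in> chart_dom c" "w \<in> tangent_space A p"
  shows "linear (\<lambda>u. \<omega> p w (coord_vec A c p u))"
  by (rule linearI) (simp_all add: assms coord_vec_add coord_vec_scale form_add_right form_scale_right
      coord_vec_in_tangent_space)

lemma smooth_on_form2_coeff: "c \<in> A \<Longrightarrow> smooth_on (chart_img c) (form2_coeff A \<omega> c u v)"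
  using two_form unfolding two_form_def by blast

lemma form_in_chart:
  assumes "c \<in> A" "p \<in> chart_dom c" "v \<in> tangent_space A p" "w \<in> tangent_space A p"
  shows "\<omega> p v w = (\<Sum>a\<in>Basis. (v c \<bullet> a) *\<^sub>R (\<Sum>b\<in>Basis. (w c \<bullet> b) *\<^sub>R form2_coeff A \<omega> c a b (chart_map c p)))"
proof -
  have "\<omega> p v w = \<omega> p (coord_vec A c p (v c)) w" by (simp add: tangent_eq_coord_vec assms)
  also have "\<dots> = (\<Sum>a\<in>Basis. (v c \<bullet> a) *\<^sub>R \<omega> p (coord_vec A c p a) w)"
    by (rule linear_eq_sum_Basis[OF linear_form_left[OF assms(1,2,4)]])
  also have "\<dots> = (\<Sum>a\<in>Basis. (v c \<bullet> a) *\<^sub>R \<omega> p (coord_vec A c p a) (coord_vec A c p (w c)))"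
    by (simp add: tangent_eq_coord_vec assms)
  also have "\<dots> = (\<Sum>a\<in>Basis. (v c \<bullet> a) *\<^sub>R (\<Sum>b\<in>Basis. (w c \<bullet> b) *\<^sub>R form2_coeff A \<omega> c a b (chart_map c p)))"
    by (subst linear_eq_sum_Basis[OF linear_form_right[OF assms(1,2) coord_vec_in_tangent_space[OF assms(1,2)]]])
      (simp add: form2_coeff_def chart_inv_map assms)
  finally show ?thesis .
qed

lemma smooth_on_form:
  assumes h: "smooth_into A S h" and V: "smooth_along A S h V" and W: "smooth_along A S h W"
    and VT: "\<And>x. x \<in> S \<Longrightarrow> V x \<in> tangent_space A (h x)"
    and WT: "\<And>x. x \<in> S \<Longrightarrow> W x \<in> tangent_space A (h x)"
  shows "smooth_on S (\<lambda>x. \<omega> (h x) (V x) (W x))"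
proof (rule smooth_on_chartwise[of S h])
  show "continuous_on S h" using h by (simp add: smooth_into_def)
  fix c assume c: "c \<in> A"
  let ?S = "{x \<in> S. h x \<in> chart_dom c}"
  have Vc: "smooth_on ?S (\<lambda>x. V x c)" "smooth_on ?S (\<lambda>x. W x c)" using V W c by (simp_all add: smooth_along_def)
  have "smooth_on ?S (\<lambda>x. \<Sum>a\<in>Basis. (V x c \<bullet> a) *\<^sub>R
      (\<Sum>b\<in>Basis. (W x c \<bullet> b) *\<^sub>R form2_coeff A \<omega> c a b (chart_map c (h x))))"
    by (intro smooth_on_sum smooth_on_scaleR smooth_on_inner Vc smooth_on_const
        smooth_on_compose[OF smooth_into_chart[OF h c] smooth_on_form2_coeff[OF c]])
      (simp add: chart_map_in)
  then show "smooth_on ?S (\<lambda>x. \<omega> (h x) (V x) (W x))"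
    by (rule smooth_on_cong) (simp add: form_in_chart[OF c _ VT WT])
qed

text \<open>The musical map \<open>v \<mapsto> \<omega>(v, \<cdot>)\<close> read in a chart, with covectors identified with vectors through the
  inner product of the model space.\<close>
definition form_operator :: "('a, 'e) chart \<Rightarrow> 'e \<Rightarrow> 'e \<Rightarrow> 'e" where
  "form_operator c x u = (\<Sum>b\<in>Basis. form2_coeff A \<omega> c u b x *\<^sub>R b)"

lemma form_operator_inner:
  assumes "c \<in> A" "x \<in> chart_img c" "w \<in> tangent_space A (chart_inv c x)"
  shows "\<omega> (chart_inv c x) (coord_vec A c (chart_inv c x) u) w = form_operator c x u \<bullet> w c"
proof -
  note p = assms(1) chart_inv_in[OF assms(1,2)]
  have "\<omega> (chart_inv c x) (coord_vec A c (chart_inv c x) u) w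
      = (\<Sum>b\<in>Basis. (w c \<bullet> b) *\<^sub>R form2_coeff A \<omega> c u b x)"
    using linear_eq_sum_Basis[OF linear_form_right[OF p coord_vec_in_tangent_space[OF p]], of u "w c"]
      tangent_eq_coord_vec[OF assms(3) p]
    by (simp add: form2_coeff_def)
  then show ?thesis by (simp add: form_operator_def inner_sum_left inner_commute[of "w c"] mult.commute)
qed

lemma linear_form_operator:
  assumes "c \<in> A" "x \<in> chart_img c"
  shows "linear (form_operator c x)"
proof -
  note p = assms(1) chart_inv_in[OF assms]
  note L = linear_form_left[OF p coord_vec_in_tangent_space[OF p]]
  show ?thesis
    unfolding form_operator_def form2_coeff_def
    by (rule linearI) (simp_all add: linear_add[OF L] linear_scale[OF L] scaleR_add_left sum.distrib scaleR_sum_right)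
qed

lemma inj_form_operator:
  assumes "c \<in> A" "x \<in> chart_img c"
  shows "inj (form_operator c x)"
  unfolding linear_injective_0[OF linear_form_operator[OF assms]]
proof (intro allI impI)
  note p = assms(1) chart_inv_in[OF assms]
  fix u assume "form_operator c x u = 0"
  then have "coord_vec A c (chart_inv c x) u = (\<lambda>c. 0)"
    using form_operator_inner[OF assms] form_zero_left
    by (intro form_eqI[OF coord_vec_in_tangent_space[OF p] tangent_space_zero]) simp
  then show "u = 0" using coord_vec_same[OF p, of u] by simp
qed

text \<open>Read in a chart, the equation defining the Hamiltonian vector field is a linear system for the
  components of the field, with minus the gradient of \<open>f\<close> on the right.\<close>
lemma hamiltonian_in_chart:
  assumes f: "f \<in> C_inf A" and c: "c \<in> A" "x \<in> chart_img c" and v: "v \<in> tangent_space A (chart_inv c x)"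
  shows "(\<forall>w\<in>tangent_space A (chart_inv c x). \<omega> (chart_inv c x) v w = - differential A f (chart_inv c x) w) \<longleftrightarrow>
    form_operator c x (v c) = (\<Sum>b\<in>Basis. (- frechet_derivative (\<lambda>x. f (chart_inv c x)) (at x) b) *\<^sub>R b)"
    (is "?ham \<longleftrightarrow> _ = ?g")
proof -
  note p = c(1) chart_inv_in[OF c]
  let ?p = "chart_inv c x"
  have \<omega>: "\<omega> ?p v w = form_operator c x (v c) \<bullet> w c" if "w \<in> tangent_space A ?p" for w
    using form_operator_inner[OF c that, of "v c"] by (simp add: tangent_eq_coord_vec[OF v p])
  have df: "- differential A f ?p w = ?g \<bullet> w c" if "w \<in> tangent_space A ?p" for w
    using differential_in_chart[OF f p that] linear_eq_sum_Basis[OF linear_chart_derivative[OF f p], of "w c"]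
    by (simp add: chart_map_inv[OF c] inner_sum_left inner_commute[of "w c"] mult.commute sum_negf)
  show ?thesis
  proof
    assume ?ham
    then have "form_operator c x (v c) \<bullet> b = ?g \<bullet> b" for b
      using \<omega>[of "coord_vec A c ?p b"] df[of "coord_vec A c ?p b"]
      by (simp add: coord_vec_in_tangent_space[OF p] coord_vec_same[OF p])
    then show "form_operator c x (v c) = ?g" by (rule euclidean_eqI)
  next
    assume "form_operator c x (v c) = ?g"
    then show ?ham using \<omega> df by simp
  qed
qed

lemma pointwise_hamiltonian_exists:
  assumes f: "f \<in> C_inf A"
  shows "\<exists>v\<in>tangent_space A p. \<forall>w\<in>tangent_space A p. \<omega> p v w = - differential A f p w"
proof -
  obtain c where c: "c \<in> A" "p \<in> chart_dom c" by (rule chart_around)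
  define x where "x = chart_map c p"
  have x: "x \<in> chart_img c" and p: "chart_inv c x = p" using c by (simp_all add: x_def chart_map_in chart_inv_map)
  have "surj (form_operator c x)"
    using linear_injective_imp_surjective[OF linear_form_operator inj_form_operator] c x by simp
  then obtain u where "(\<Sum>b\<in>Basis. (- frechet_derivative (\<lambda>x. f (chart_inv c x)) (at x) b) *\<^sub>R b) = form_operator c x u"
    by (rule surjE)
  then show ?thesis
    using hamiltonian_in_chart[OF f c(1) x, of "coord_vec A c p u"] c
    by (intro bexI[of _ "coord_vec A c p u"]) (simp_all add: p coord_vec_same coord_vec_in_tangent_space)
qed

text \<open>Pointwise existence is surjectivity of the injective operator of the linear system; smoothness of
  the resulting field is smoothness of the solutions of a linear system with smooth coefficients.\<close>
lemma hamiltonian_vf_exists: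
  assumes f: "f \<in> C_inf A"
  shows "\<exists>!X. is_hamiltonian_vf A \<omega> f X"
proof -
  have "\<forall>p. \<exists>v. v \<in> tangent_space A p \<and> (\<forall>w\<in>tangent_space A p. \<omega> p v w = - differential A f p w)"
    using pointwise_hamiltonian_exists[OF f] by blast
  from choice[OF this] obtain X where X: "\<And>p. X p \<in> tangent_space A p"
    "\<And>p w. w \<in> tangent_space A p \<Longrightarrow> \<omega> p (X p) w = - differential A f p w" by blast
  have "smooth_on (chart_img c) (\<lambda>x. X (chart_inv c x) c)" if c: "c \<in> A" for c
  proof (rule smooth_on_linear_solve[OF open_chart_img[OF c]])
    show "smooth_on (chart_img c) (\<lambda>x. form_operator c x u)" for u
      unfolding form_operator_def
      by (intro smooth_on_sum smooth_on_scaleR smooth_on_const smooth_on_form2_coeff[OF c])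
    show "smooth_on (chart_img c) (\<lambda>x. \<Sum>b\<in>Basis. (- frechet_derivative (\<lambda>x. f (chart_inv c x)) (at x) b) *\<^sub>R b)"
      by (intro smooth_on_sum smooth_on_scaleR smooth_on_const
          smooth_on_linear[OF bounded_linear_minus[OF bounded_linear_ident]]
          smooth_on_frechet_derivative[OF smooth_on_C_inf[OF f c] open_chart_img[OF c]])
    fix x assume x: "x \<in> chart_img c"
    show "linear (form_operator c x)" "inj (form_operator c x)"
      by (rule linear_form_operator[OF c x] inj_form_operator[OF c x])+
    show "form_operator c x (X (chart_inv c x) c)
        = (\<Sum>b\<in>Basis. (- frechet_derivative (\<lambda>x. f (chart_inv c x)) (at x) b) *\<^sub>R b)"
      using hamiltonian_in_chart[OF f c x X(1)] X(2) by blast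
  qed
  then have "is_hamiltonian_vf A \<omega> f X" using X by (simp add: is_hamiltonian_vf_def vector_fields_def)
  moreover have "Y = X" if "is_hamiltonian_vf A \<omega> f Y" for Y
  proof
    fix p show "Y p = X p"
      using that X form_eqI[of "Y p" p "X p"] by (simp add: is_hamiltonian_vf_def vector_fields_def)
  qed
  ultimately show ?thesis by blast
qed

lemma is_hamiltonian_vf:
  assumes "f \<in> C_inf A"
  shows "is_hamiltonian_vf A \<omega> f (hamiltonian_vf A \<omega> f)"
  unfolding hamiltonian_vf_def by (rule theI'[OF hamiltonian_vf_exists[OF assms]])

lemma hamiltonian_vf_props:
  assumes "f \<in> C_inf A"
  shows "hamiltonian_vf A \<omega> f \<in> vector_fields A"
    and "hamiltonian_vf A \<omega> f p \<in> tangent_space A p"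
    and "w \<in> tangent_space A p \<Longrightarrow> \<omega> p (hamiltonian_vf A \<omega> f p) w = - differential A f p w"
  using is_hamiltonian_vf[OF assms] by (auto simp: is_hamiltonian_vf_def vector_fields_def)

lemma hamiltonian_vf_add:
  assumes "f \<in> C_inf A" "g \<in> C_inf A"
  shows "hamiltonian_vf A \<omega> (\<lambda>p. f p + g p) p = tadd (hamiltonian_vf A \<omega> f p) (hamiltonian_vf A \<omega> g p)"
  by (rule form_eqI[where p = p])
    (simp_all add: hamiltonian_vf_props assms C_inf_add tangent_space_tadd form_add_left differential_add)

end

section \<open>Smooth maps into the manifold and vector fields along them\<close>

context smooth_manifold
begin

lemma smooth_into_subset:
  assumes "smooth_into A S h" "T \<subseteq> S"
  shows "smooth_into A T h"
  unfolding smooth_into_def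
proof (intro conjI ballI)
  show "continuous_on T h" using assms by (auto simp: smooth_into_def intro: continuous_on_subset)
  fix c assume "c \<in> A"
  then have "smooth_on {x \<in> S. h x \<in> chart_dom c} (chart_map c \<circ> h)" using assms by (simp add: smooth_into_def)
  then show "smooth_on {x \<in> T. h x \<in> chart_dom c} (chart_map c \<circ> h)"
    by (rule smooth_on_subset) (use assms in auto)
qed

lemma smooth_into_cong:
  assumes "smooth_into A S h" "\<And>x. x \<in> S \<Longrightarrow> h' x = h x"
  shows "smooth_into A S h'"
proof -
  have "{x \<in> S. h' x \<in> chart_dom c} = {x \<in> S. h x \<in> chart_dom c}" for c :: "('a, 'e) chart"
    using assms(2) by auto
  then show ?thesis
    using assms unfolding smooth_into_def
    by (auto simp: continuous_on_eq intro: smooth_on_cong[where f = "chart_map _ \<circ> h"])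
qed

lemma smooth_into_local:
  assumes "\<And>x. x \<in> S \<Longrightarrow> \<exists>N. open N \<and> x \<in> N \<and> smooth_into A (S \<inter> N) h"
  shows "smooth_into A S h"
  unfolding smooth_into_def
proof (intro conjI ballI)
  show "continuous_on S h"
    unfolding continuous_on_eq_continuous_within
  proof
    fix x assume x: "x \<in> S"
    obtain N where N: "open N" "x \<in> N" "smooth_into A (S \<inter> N) h" using assms[OF x] by blast
    then have "continuous (at x within S \<inter> N) h"
      using x by (simp add: smooth_into_def continuous_on_eq_continuous_within)
    moreover have "at x within S \<inter> N = at x within S"
      by (rule at_within_nhd[OF N(2,1)]) auto
    ultimately show "continuous (at x within S) h" by simp
  qed
  fix c assume c: "c \<in> A"
  show "smooth_on {x \<in> S. h x \<in> chart_dom c} (chart_map c \<circ> h)"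
  proof (rule smooth_on_local)
    fix x assume x: "x \<in> {x \<in> S. h x \<in> chart_dom c}"
    then obtain N where N: "open N" "x \<in> N" "smooth_into A (S \<inter> N) h" using assms by blast
    have "{x \<in> S. h x \<in> chart_dom c} \<inter> N = {x \<in> S \<inter> N. h x \<in> chart_dom c}" by blast
    then show "\<exists>N. open N \<and> x \<in> N \<and> smooth_on ({x \<in> S. h x \<in> chart_dom c} \<inter> N) (chart_map c \<circ> h)"
      using N c by (auto simp: smooth_into_def)
  qed
qed

lemma smooth_into_chart_inv:
  assumes c: "c \<in> A" and y: "smooth_on S y" "\<And>x. x \<in> S \<Longrightarrow> y x \<in> chart_img c"
  shows "smooth_into A S (\<lambda>x. chart_inv c (y x))"
  unfolding smooth_into_def
proof (intro conjI ballI)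
  show "continuous_on S (\<lambda>x. chart_inv c (y x))"
    by (rule continuous_on_compose2[OF continuous_on_chart_inv[OF c] smooth_on_imp_continuous_on[OF y(1)]])
      (use y in auto)
  fix c' assume c': "c' \<in> A"
  let ?S = "{x \<in> S. chart_inv c (y x) \<in> chart_dom c'}"
  have "smooth_on ?S y" using y(1) by (rule smooth_on_subset) auto
  from smooth_on_compose[OF this smooth_on_transition[OF c c']]
  show "smooth_on ?S (chart_map c' \<circ> (\<lambda>x. chart_inv c (y x)))"
    unfolding overlap_eq[OF c] by (auto simp: comp_def y(2))
qed

lemma smooth_along_local:
  assumes "\<And>x. x \<in> S \<Longrightarrow> \<exists>N. open N \<and> x \<in> N \<and> smooth_along A (S \<inter> N) h V"
  shows "smooth_along A S h V"
  unfolding smooth_along_def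
proof
  fix c assume c: "c \<in> A"
  show "smooth_on {x \<in> S. h x \<in> chart_dom c} (\<lambda>x. V x c)"
  proof (rule smooth_on_local)
    fix x assume x: "x \<in> {x \<in> S. h x \<in> chart_dom c}"
    then obtain N where N: "open N" "x \<in> N" "smooth_along A (S \<inter> N) h V" using assms by blast
    have "{x \<in> S. h x \<in> chart_dom c} \<inter> N = {x \<in> S \<inter> N. h x \<in> chart_dom c}" by blast
    then show "\<exists>N. open N \<and> x \<in> N \<and> smooth_on ({x \<in> S. h x \<in> chart_dom c} \<inter> N) (\<lambda>x. V x c)"
      using N c by (auto simp: smooth_along_def)
  qed
qed

lemma smooth_along_cong:
  assumes "smooth_along A S h V" "\<And>x. x \<in> S \<Longrightarrow> V' x = V x"
  shows "smooth_along A S h V'"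
  using assms unfolding smooth_along_def by (auto intro: smooth_on_cong[where f = "\<lambda>x. V x _"])

lemma smooth_along_subset:
  assumes "smooth_along A S h V" "T \<subseteq> S"
  shows "smooth_along A T h V"
  unfolding smooth_along_def
proof
  fix c assume "c \<in> A"
  then have "smooth_on {x \<in> S. h x \<in> chart_dom c} (\<lambda>x. V x c)" using assms by (simp add: smooth_along_def)
  then show "smooth_on {x \<in> T. h x \<in> chart_dom c} (\<lambda>x. V x c)"
    by (rule smooth_on_subset) (use assms in auto)
qed

lemma smooth_along_zero: "smooth_along A S h (\<lambda>x c. 0)"
  by (simp add: smooth_along_def smooth_on_const)

lemma smooth_along_tscale:
  assumes r: "smooth_on S r" and V: "smooth_along A S h V"
  shows "smooth_along A S h (\<lambda>x. tscale (r x) (V x))"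
  unfolding smooth_along_def tscale_def
proof
  fix c assume "c \<in> A"
  then show "smooth_on {x \<in> S. h x \<in> chart_dom c} (\<lambda>x. r x *\<^sub>R V x c)"
    using V by (intro smooth_on_scaleR smooth_on_subset[OF r]) (auto simp: smooth_along_def)
qed

lemma smooth_along_tsum:
  assumes "\<And>i. i \<in> I \<Longrightarrow> smooth_along A S h (V i)"
  shows "smooth_along A S h (\<lambda>x. tsum (\<lambda>i. V i x) I)"
  using assms unfolding smooth_along_def tsum_def by (intro ballI smooth_on_sum) blast

lemma smooth_along_coord_vec:
  assumes h: "smooth_into A S h" and c: "c \<in> A" and dom: "\<And>x. x \<in> S \<Longrightarrow> h x \<in> chart_dom c"
  shows "smooth_along A S h (\<lambda>x. coord_vec A c (h x) u)"
  unfolding smooth_along_def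
proof
  fix c' assume c': "c' \<in> A"
  let ?S = "{x \<in> S. h x \<in> chart_dom c'}"
  have "smooth_on ?S (\<lambda>x. chart_map c (h x))"
    using smooth_into_chart[OF h c] by (rule smooth_on_subset) (use dom in auto)
  then have "smooth_on ?S (\<lambda>x. transition_deriv c c' (chart_inv c (chart_map c (h x))) u)"
    by (rule smooth_on_compose[OF _ smooth_on_transition_deriv[OF c c']]) (use dom in auto)
  then show "smooth_on ?S (\<lambda>x. coord_vec A c (h x) u c')"
    by (rule smooth_on_cong) (simp add: coord_vec_def c c' dom chart_inv_map)
qed


section \<open>Vector fields and variations supported in a short interval\<close>

lemma path_smooth_into: "\<gamma> \<in> path_space A \<Longrightarrow> smooth_into A {0..1} \<gamma>"
  by (simp add: path_space_def)

lemma path_tangentD: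
  assumes "w \<in> path_tangent_space A \<gamma>"
  shows "t \<in> {0..1} \<Longrightarrow> w t \<in> tangent_space A (\<gamma> t)" "smooth_along A {0..1} \<gamma> w"
  using assms by (auto simp: path_tangent_space_def)

lemma path_chart_nhd:
  assumes "\<gamma> \<in> path_space A" "c \<in> A"
  obtains T where "open T" "T \<inter> {0..1} = {t \<in> {0..1}. \<gamma> t \<in> chart_dom c}"
proof -
  have "continuous_on {0..1} \<gamma>" using path_smooth_into[OF assms(1)] by (simp add: smooth_into_def)
  then obtain T where "open T" "T \<inter> {0..1} = \<gamma> -` chart_dom c \<inter> {0..1}"
    using open_chart_dom[OF assms(2)] unfolding continuous_on_open_invariant by blast
  moreover have "\<gamma> -` chart_dom c \<inter> {0..1} = {t \<in> {0..1}. \<gamma> t \<in> chart_dom c}" by blast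
  ultimately show ?thesis by (intro that[of T]) simp_all
qed

lemma integrable_C_inf_path:
  assumes "f \<in> C_inf A" "\<gamma> \<in> path_space A"
  shows "(\<lambda>t. f (\<gamma> t)) integrable_on {0..1}"
  by (intro integrable_continuous_interval smooth_on_imp_continuous_on
      smooth_on_C_inf_compose[OF assms(1) path_smooth_into[OF assms(2)]])

lemma integrable_differential_path:
  assumes "f \<in> C_inf A" "\<gamma> \<in> path_space A" "w \<in> path_tangent_space A \<gamma>"
  shows "(\<lambda>t. differential A f (\<gamma> t) (w t)) integrable_on {0..1}"
  by (intro integrable_continuous_interval smooth_on_imp_continuous_on
      smooth_on_differential[OF assms(1) path_smooth_into[OF assms(2)]] path_tangentD[OF assms(3)])

text \<open>The coordinate vector \<open>u\<close> of the chart \<open>c\<close> along \<open>\<gamma>\<close>, cut off to \<open>[a,b]\<close>; it is meaningful when \<open>\<gamma>\<close>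
  maps this interval into the chart.\<close>
definition bump_field :: "('a, 'e) chart \<Rightarrow> 'a path \<Rightarrow> real \<Rightarrow> real \<Rightarrow> 'e \<Rightarrow> ('a, 'e) path_tvec" where
  "bump_field c \<gamma> a b u =
     (\<lambda>t\<in>{0..1}. if t \<in> {a..b} then tscale (bump a b t) (coord_vec A c (\<gamma> t) u) else (\<lambda>_. 0))"

text \<open>At points of \<open>[a,b]\<close> the path is in the chart, and nearby the field is given by one smooth
  expression in the chart, because \<open>bump a b\<close> vanishes outside \<open>[a,b]\<close>. Away from \<open>[a,b]\<close> the field
  is zero.\<close>
lemma bump_field_in_path_tangent_space:
  assumes \<gamma>: "\<gamma> \<in> path_space A" and c: "c \<in> A" and ab: "\<And>t. t \<in> {a..b} \<Longrightarrow> \<gamma> t \<in> chart_dom c"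
  shows "bump_field c \<gamma> a b u \<in> path_tangent_space A \<gamma>"
  unfolding path_tangent_space_def
proof (intro CollectI conjI)
  have "bump_field c \<gamma> a b u t \<in> tangent_space A (\<gamma> t)" if "t \<in> {0..1}" for t
    using that ab[of t] c
    by (simp add: bump_field_def tangent_space_zero tangent_space_tscale coord_vec_in_tangent_space)
  then show "bump_field c \<gamma> a b u \<in> (\<Pi>\<^sub>E t\<in>{0..1}. tangent_space A (\<gamma> t))"
    by (intro PiE_I) (auto simp: bump_field_def)
  obtain T where T: "open T" "T \<inter> {0..1} = {t \<in> {0..1}. \<gamma> t \<in> chart_dom c}"
    using path_chart_nhd[OF \<gamma> c] by blast
  show "smooth_along A {0..1} \<gamma> (bump_field c \<gamma> a b u)"
  proof (rule smooth_along_local)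
    fix t :: real assume t: "t \<in> {0..1}"
    show "\<exists>N. open N \<and> t \<in> N \<and> smooth_along A ({0..1} \<inter> N) \<gamma> (bump_field c \<gamma> a b u)"
    proof (cases "t \<in> {a..b}")
      case True
      have dom: "\<gamma> t \<in> chart_dom c" if "t \<in> {0..1} \<inter> T" for t using that T(2) by blast
      have "smooth_into A ({0..1} \<inter> T) \<gamma>"
        by (rule smooth_into_subset[OF path_smooth_into[OF \<gamma>]]) blast
      from smooth_along_coord_vec[OF this c dom]
      have "smooth_along A ({0..1} \<inter> T) \<gamma> (\<lambda>t. tscale (bump a b t) (coord_vec A c (\<gamma> t) u))"
        by (rule smooth_along_tscale[OF smooth_on_bump])
      then have "smooth_along A ({0..1} \<inter> T) \<gamma> (bump_field c \<gamma> a b u)"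
        by (rule smooth_along_cong) (auto simp: bump_field_def bump_outside tscale_def)
      moreover have "t \<in> T" using T t ab[OF True] by blast
      ultimately show ?thesis using T(1) by blast
    next
      case False
      have "smooth_along A ({0..1} \<inter> - {a..b}) \<gamma> (bump_field c \<gamma> a b u)"
        by (rule smooth_along_cong[OF smooth_along_zero]) (auto simp: bump_field_def)
      moreover have "open (- {a..b})" by (simp add: open_Compl)
      ultimately show ?thesis using False by blast
    qed
  qed
qed

lemma integral_bump_field:
  assumes \<gamma>: "\<gamma> \<in> path_space A" and c: "c \<in> A" and ab: "0 \<le> a" "b \<le> 1" "\<And>t. t \<in> {a..b} \<Longrightarrow> \<gamma> t \<in> chart_dom c"
    and \<theta>: "\<And>t r v. t \<in> {0..1} \<Longrightarrow> v \<in> tangent_space A (\<gamma> t) \<Longrightarrow> \<theta> t (tscale r v) = r * \<theta> t v"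
  shows "integral {0..1} (\<lambda>t. \<theta> t (bump_field c \<gamma> a b u t))
    = integral {a..b} (\<lambda>t. bump a b t * \<theta> t (coord_vec A c (\<gamma> t) u))"
proof -
  have \<theta>0: "\<theta> t (\<lambda>_. 0) = 0" if "t \<in> {0..1}" for t
    using \<theta>[OF that tangent_space_zero, of 0] by (simp add: tscale_def)
  have "integral {0..1} (\<lambda>t. \<theta> t (bump_field c \<gamma> a b u t))
    = integral {0..1} (\<lambda>t. if t \<in> {a..b} then bump a b t * \<theta> t (coord_vec A c (\<gamma> t) u) else 0)"
    by (rule integral_cong) (use ab c in \<open>auto simp: bump_field_def \<theta>0 \<theta> coord_vec_in_tangent_space\<close>)
  also have "\<dots> = integral ({a..b} \<inter> {0..1}) (\<lambda>t. bump a b t * \<theta> t (coord_vec A c (\<gamma> t) u))"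
    by (rule integral_restrict_Int)
  also have "{a..b} \<inter> {0..1} = {a..b}" using ab by auto
  finally show ?thesis .
qed

text \<open>The functional \<open>\<theta> t\<close> stands for a covector at \<open>\<gamma> t\<close>. Testing with bump fields in one coordinate
  direction reduces the claim to the scalar fundamental lemma. It is used once for
  \<open>\<omega> (\<gamma> t) (v t - v' t)\<close>, giving weak nondegeneracy, and once for \<open>dh - dk\<close>, giving uniqueness of
  the differential.\<close>
lemma covector_along_path_zero:
  assumes \<gamma>: "\<gamma> \<in> path_space A"
    and scale: "\<And>t r v. t \<in> {0..1} \<Longrightarrow> v \<in> tangent_space A (\<gamma> t) \<Longrightarrow> \<theta> t (tscale r v) = r * \<theta> t v"
    and cont: "\<And>c u. c \<in> A \<Longrightarrow> continuous_on {t \<in> {0..1}. \<gamma> t \<in> chart_dom c} (\<lambda>t. \<theta> t (coord_vec A c (\<gamma> t) u))"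
    and zero: "\<And>c a b u. c \<in> A \<Longrightarrow> 0 \<le> a \<Longrightarrow> a < b \<Longrightarrow> b \<le> 1 \<Longrightarrow> (\<And>t. t \<in> {a..b} \<Longrightarrow> \<gamma> t \<in> chart_dom c) \<Longrightarrow>
      integral {0..1} (\<lambda>t. \<theta> t (bump_field c \<gamma> a b u t)) = 0"
    and t: "t \<in> {0..1}" and v: "v \<in> tangent_space A (\<gamma> t)"
  shows "\<theta> t v = 0"
proof -
  obtain c where c: "c \<in> A" "\<gamma> t \<in> chart_dom c" by (rule chart_around)
  obtain T where T: "open T" "T \<inter> {0..1} = {t \<in> {0..1}. \<gamma> t \<in> chart_dom c}"
    using path_chart_nhd[OF \<gamma> c(1)] by blast
  have "\<theta> t (coord_vec A c (\<gamma> t) (v c)) = 0"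
  proof (rule bump_integrals_zero_imp_zero[OF T(1) _ t])
    show "t \<in> T" using T t c by blast
    show "continuous_on (T \<inter> {0..1}) (\<lambda>t. \<theta> t (coord_vec A c (\<gamma> t) (v c)))"
      unfolding T(2) by (rule cont[OF c(1)])
    fix a b :: real assume ab: "0 \<le> a" "a < b" "b \<le> 1" "{a..b} \<subseteq> T"
    have dom: "\<gamma> t \<in> chart_dom c" if "t \<in> {a..b}" for t
      using that ab T(2) by (auto simp: set_eq_iff subset_iff)
    show "integral {a..b} (\<lambda>t. bump a b t * \<theta> t (coord_vec A c (\<gamma> t) (v c))) = 0"
      using zero[OF c(1) ab(1-3) dom, of "v c"]
        integral_bump_field[where \<theta> = \<theta> and u = "v c", OF \<gamma> c(1) ab(1,3) dom scale] by simp
  qed simp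
  then show ?thesis by (simp add: tangent_eq_coord_vec v c)
qed

text \<open>The curve of paths, with parameter \<open>s\<close>, whose velocity at \<open>s = 0\<close> is the corresponding bump field.
  It moves \<open>\<gamma>\<close> along straight lines of the chart.\<close>
definition bump_variation :: "('a, 'e) chart \<Rightarrow> 'a path \<Rightarrow> real \<Rightarrow> real \<Rightarrow> 'e \<Rightarrow> real \<Rightarrow> 'a path" where
  "bump_variation c \<gamma> a b u s =
     (\<lambda>t\<in>{0..1}. if t \<in> {a..b} then chart_inv c (chart_map c (\<gamma> t) + (s * bump a b t) *\<^sub>R u) else \<gamma> t)"

lemma bump_variation_zero:
  assumes \<gamma>: "\<gamma> \<in> path_space A" and c: "c \<in> A" and ab: "\<And>t. t \<in> {a..b} \<Longrightarrow> \<gamma> t \<in> chart_dom c"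
  shows "bump_variation c \<gamma> a b u 0 = \<gamma>"
proof
  fix t
  show "bump_variation c \<gamma> a b u 0 t = \<gamma> t"
  proof (cases "t \<in> {0..1}")
    case True
    then show ?thesis using ab[of t] c by (simp add: bump_variation_def chart_inv_map)
  next
    case False
    have "\<gamma> \<in> extensional {0..1}" using \<gamma> by (simp add: path_space_def)
    from extensional_arb[OF this False] show ?thesis by (simp only: bump_variation_def restrict_def False if_False)
  qed
qed

lemma bump_variation_in_path_space:
  assumes \<gamma>: "\<gamma> \<in> path_space A" and c: "c \<in> A" and ab: "\<And>t. t \<in> {a..b} \<Longrightarrow> \<gamma> t \<in> chart_dom c"
    and img: "\<And>t. t \<in> {a..b} \<Longrightarrow> chart_map c (\<gamma> t) + (s * bump a b t) *\<^sub>R u \<in> chart_img c"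
  shows "bump_variation c \<gamma> a b u s \<in> path_space A"
  unfolding path_space_def
proof (intro CollectI conjI)
  show "bump_variation c \<gamma> a b u s \<in> extensional {0..1}" by (simp add: bump_variation_def)
  obtain T where T: "open T" "T \<inter> {0..1} = {t \<in> {0..1}. \<gamma> t \<in> chart_dom c}"
    using path_chart_nhd[OF \<gamma> c] by blast
  show "smooth_into A {0..1} (bump_variation c \<gamma> a b u s)"
  proof (rule smooth_into_local)
    fix t :: real assume t: "t \<in> {0..1}"
    show "\<exists>N. open N \<and> t \<in> N \<and> smooth_into A ({0..1} \<inter> N) (bump_variation c \<gamma> a b u s)"
    proof (cases "t \<in> {a..b}")
      case True
      let ?y = "\<lambda>t. chart_map c (\<gamma> t) + (s * bump a b t) *\<^sub>R u"
      have dom: "\<gamma> t \<in> chart_dom c" if "t \<in> {0..1} \<inter> T" for t using that T(2) by blast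
      have "smooth_on ({0..1} \<inter> T) (\<lambda>t. chart_map c (\<gamma> t))"
        by (rule smooth_on_subset[OF smooth_into_chart[OF path_smooth_into[OF \<gamma>] c]]) (use T in auto)
      then have y: "smooth_on ({0..1} \<inter> T) ?y"
        by (intro smooth_on_add smooth_on_scaleR smooth_on_mult smooth_on_const smooth_on_bump)
      have "?y t \<in> chart_img c" if "t \<in> {0..1} \<inter> T" for t
        using img[of t] dom[OF that] chart_map_in[of "\<gamma> t" c]
        by (cases "t \<in> {a..b}") (auto simp: bump_outside)
      then have "smooth_into A ({0..1} \<inter> T) (\<lambda>t. chart_inv c (?y t))"
        by (intro smooth_into_chart_inv[OF c y])
      then have "smooth_into A ({0..1} \<inter> T) (bump_variation c \<gamma> a b u s)"
        by (rule smooth_into_cong) (use dom c in \<open>auto simp: bump_variation_def bump_outside chart_inv_map\<close>)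
      moreover have "t \<in> T" using T t ab[OF True] by blast
      ultimately show ?thesis using T(1) by blast
    next
      case False
      have "smooth_into A ({0..1} \<inter> - {a..b}) \<gamma>"
        using path_smooth_into[OF \<gamma>] by (rule smooth_into_subset) auto
      then have "smooth_into A ({0..1} \<inter> - {a..b}) (bump_variation c \<gamma> a b u s)"
        by (rule smooth_into_cong) (auto simp: bump_variation_def)
      moreover have "open (- {a..b})" by (simp add: open_Compl)
      ultimately show ?thesis using False by blast
    qed
  qed
qed

text \<open>The image of the compact interval \<open>[a,b]\<close> in the chart has a positive distance from the complement
  of the open set \<open>chart_img c\<close>, and the displacement is at most \<open>\<bar>s\<bar> norm u\<close>,
  because the bump function is bounded by 1.\<close>
lemma bump_variation_stays_in_chart:
  assumes \<gamma>: "\<gamma> \<in> path_space A" and c: "c \<in> A" and ab: "0 \<le> a" "b \<le> 1" "\<And>t. t \<in> {a..b} \<Longrightarrow> \<gamma> t \<in> chart_dom c"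
  obtains \<epsilon> where "\<epsilon> > 0"
    "\<And>s t. \<bar>s\<bar> < \<epsilon> \<Longrightarrow> t \<in> {a..b} \<Longrightarrow> chart_map c (\<gamma> t) + (s * bump a b t) *\<^sub>R u \<in> chart_img c"
proof -
  have "continuous_on {a..b} (\<lambda>t. chart_map c (\<gamma> t))"
    by (rule continuous_on_subset[OF smooth_on_imp_continuous_on[OF smooth_into_chart[OF path_smooth_into[OF \<gamma>] c]]])
      (use ab in auto)
  then have "compact ((\<lambda>t. chart_map c (\<gamma> t)) ` {a..b})" by (rule compact_continuous_image) simp
  moreover have "(\<lambda>t. chart_map c (\<gamma> t)) ` {a..b} \<subseteq> chart_img c" using ab(3) by (auto intro: chart_map_in)
  ultimately obtain e where e: "e > 0" "(\<Union>x\<in>(\<lambda>t. chart_map c (\<gamma> t)) ` {a..b}. ball x e) \<subseteq> chart_img c"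
    using compact_subset_open_imp_ball_epsilon_subset[OF _ open_chart_img[OF c]] by metis
  \<comment> \<open>adding 1 to the denominator covers \<open>u = 0\<close>\<close>
  show ?thesis
  proof (rule that[of "e / (norm u + 1)"])
    show "e / (norm u + 1) > 0" using e by (simp add: add_nonneg_pos)
    fix s t assume s: "\<bar>s\<bar> < e / (norm u + 1)" and t: "t \<in> {a..b}"
    have "norm ((s * bump a b t) *\<^sub>R u) \<le> \<bar>s\<bar> * norm u"
      using mult_left_le[OF bump_le_1[of a b t], of "\<bar>s\<bar> * norm u"] bump_nonneg[of a b t]
      by (simp add: abs_mult ac_simps)
    also have "\<dots> \<le> \<bar>s\<bar> * (norm u + 1)" by (intro mult_left_mono) auto
    also have "\<dots> < e" using s by (simp add: pos_less_divide_eq add_nonneg_pos)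
    finally have "chart_map c (\<gamma> t) + (s * bump a b t) *\<^sub>R u \<in> ball (chart_map c (\<gamma> t)) e"
      by (simp add: dist_norm)
    then show "chart_map c (\<gamma> t) + (s * bump a b t) *\<^sub>R u \<in> chart_img c" using e(2) t by blast
  qed
qed

text \<open>Only the part of the integral over \<open>[a,b]\<close> depends on \<open>s\<close>, and there the integrand is a smooth
  function of the coordinates, to be differentiated under the integral.\<close>
lemma induced_bump_variation_derivative:
  assumes \<gamma>: "\<gamma> \<in> path_space A" and c: "c \<in> A" and ab: "0 \<le> a" "b \<le> 1" "\<And>t. t \<in> {a..b} \<Longrightarrow> \<gamma> t \<in> chart_dom c"
    and \<epsilon>: "\<epsilon> > 0"
    "\<And>s t. \<bar>s\<bar> < \<epsilon> \<Longrightarrow> t \<in> {a..b} \<Longrightarrow> chart_map c (\<gamma> t) + (s * bump a b t) *\<^sub>R u \<in> chart_img c"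
    and f: "f \<in> C_inf A"
  shows "((\<lambda>s. integral {0..1} (\<lambda>t. f (bump_variation c \<gamma> a b u s t))) has_real_derivative
    integral {0..1} (\<lambda>t. differential A f (\<gamma> t) (bump_field c \<gamma> a b u t))) (at 0)"
proof -
  let ?F = "\<lambda>x. f (chart_inv c x)"
  let ?y = "\<lambda>s t. chart_map c (\<gamma> t) + (s * bump a b t) *\<^sub>R u"
  let ?d = "\<lambda>s t. bump a b t * frechet_derivative ?F (at (?y s t)) u"
  let ?U = "{-\<epsilon><..<\<epsilon>}"
  have img: "?y s t \<in> chart_img c" if "s \<in> ?U" "t \<in> {a..b}" for s t using that by (intro \<epsilon>) auto
  have c\<gamma>: "continuous_on {a..b} (\<lambda>t. chart_map c (\<gamma> t))"
    by (rule continuous_on_subset[OF smooth_on_imp_continuous_on[OF smooth_into_chart[OF path_smooth_into[OF \<gamma>] c]]])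
      (use ab in auto)
  have cb: "continuous_on S (bump a b)" for S
    by (rule smooth_on_imp_continuous_on[OF smooth_on_bump])
  have cy: "continuous_on (?U \<times> {a..b}) (\<lambda>x. ?y (fst x) (snd x))"
    by (intro continuous_intros continuous_on_compose2[OF c\<gamma>] continuous_on_compose2[OF cb[of UNIV]]) auto
  have cF: "continuous_on (chart_img c) ?F"
    by (rule smooth_on_imp_continuous_on[OF smooth_on_C_inf[OF f c]])
  have cG: "continuous_on {a..b} (\<lambda>t. ?F (?y s t))" if "s \<in> ?U" for s
    by (rule continuous_on_compose2[OF cF])
      (use img[OF that] in \<open>auto intro!: continuous_intros c\<gamma> cb\<close>)
  have cf: "continuous_on {0..1} (\<lambda>t. f (\<gamma> t))"
    by (rule smooth_on_imp_continuous_on[OF smooth_on_C_inf_compose[OF f path_smooth_into[OF \<gamma>]]])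
  then have cf': "continuous_on {a..b} (\<lambda>t. f (\<gamma> t))" by (rule continuous_on_subset) (use ab in auto)
  have inter: "{a..b} \<inter> {0..1} = {a..b}" using ab by auto
  have D': "((\<lambda>s. integral (cbox a b) (\<lambda>t. ?F (?y s t) - f (\<gamma> t))) has_real_derivative
    integral (cbox a b) (?d 0)) (at 0 within ?U)"
  proof (rule leibniz_rule_field_derivative)
    show "(\<lambda>t. ?F (?y s t) - f (\<gamma> t)) integrable_on cbox a b" if "s \<in> ?U" for s
      using cG[OF that] cf' by (auto intro!: integrable_continuous_interval continuous_intros)
    show "continuous_on (?U \<times> cbox a b) (\<lambda>(s, t). ?d s t)"
      unfolding case_prod_beta
      by (intro continuous_on_mult continuous_on_compose2[OF cb[of UNIV]]
          continuous_on_compose2[OF smooth_on_imp_continuous_on[OF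
              smooth_on_frechet_derivative[OF smooth_on_C_inf[OF f c] open_chart_img[OF c]]] cy[folded cbox_interval]])
        (use img in \<open>auto intro!: continuous_intros\<close>)
    fix s t assume st: "s \<in> ?U" "t \<in> cbox a b"
    then have x: "?y s t \<in> chart_img c" using img by auto
    have "((\<lambda>s. ?y s t) has_derivative (\<lambda>r. (r * bump a b t) *\<^sub>R u)) (at s within ?U)"
      by (auto intro!: derivative_eq_intros)
    from has_derivative_compose[OF this C_inf_has_derivative[OF f c x]]
    have "((\<lambda>s. ?F (?y s t)) has_derivative (\<lambda>r. frechet_derivative ?F (at (?y s t)) ((r * bump a b t) *\<^sub>R u)))
      (at s within ?U)" .
    moreover have "frechet_derivative ?F (at (?y s t)) ((r * bump a b t) *\<^sub>R u) = ?d s t * r" for r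
      by (simp add: linear_scale[OF has_derivative_linear[OF C_inf_has_derivative[OF f c x]]])
    ultimately have "((\<lambda>s. ?F (?y s t)) has_real_derivative ?d s t) (at s within ?U)"
      by (simp add: has_field_derivative_def)
    then show "((\<lambda>s. ?F (?y s t) - f (\<gamma> t)) has_real_derivative ?d s t) (at s within ?U)"
      using DERIV_diff[OF _ DERIV_const] by fastforce
  qed (use \<epsilon> in auto)
  have D: "((\<lambda>s. integral {a..b} (\<lambda>t. ?F (?y s t) - f (\<gamma> t))) has_real_derivative
    integral {a..b} (?d 0)) (at 0)"
  proof -
    have "open ?U" "0 \<in> ?U" using \<epsilon>(1) by auto
    from at_within_open[OF this(2,1)] show ?thesis
      using D' by (simp only: cbox_interval)
  qed
  have "integral {0..1} (\<lambda>t. f (bump_variation c \<gamma> a b u s t))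
    = integral {0..1} (\<lambda>t. f (\<gamma> t)) + integral {a..b} (\<lambda>t. ?F (?y s t) - f (\<gamma> t))" if "s \<in> ?U" for s
  proof -
    let ?h = "\<lambda>t. if t \<in> {a..b} then ?F (?y s t) - f (\<gamma> t) else 0"
    have int: "?h integrable_on {0..1}"
      unfolding integrable_restrict_Int inter
      using cG[OF that] cf' by (intro integrable_continuous_interval continuous_intros)
    have "integral {0..1} (\<lambda>t. f (bump_variation c \<gamma> a b u s t)) = integral {0..1} (\<lambda>t. f (\<gamma> t) + ?h t)"
      by (rule integral_cong) (auto simp: bump_variation_def)
    also have "\<dots> = integral {0..1} (\<lambda>t. f (\<gamma> t)) + integral {0..1} ?h"
      by (rule Henstock_Kurzweil_Integration.integral_add[OF integrable_C_inf_path[OF f \<gamma>] int])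
    also have "integral {0..1} ?h = integral {a..b} (\<lambda>t. ?F (?y s t) - f (\<gamma> t))"
      unfolding integral_restrict_Int inter ..
    finally show ?thesis .
  qed
  note split = this
  have "((\<lambda>s. integral {0..1} (\<lambda>t. f (\<gamma> t)) + integral {a..b} (\<lambda>t. ?F (?y s t) - f (\<gamma> t))) has_real_derivative
    integral {a..b} (?d 0)) (at 0)"
    using DERIV_add[OF DERIV_const D, of "integral {0..1} (\<lambda>t. f (\<gamma> t))"] by (simp only: add_0_left)
  then have "((\<lambda>s. integral {0..1} (\<lambda>t. f (bump_variation c \<gamma> a b u s t))) has_real_derivative
    integral {a..b} (?d 0)) (at 0)"
    by (rule has_field_derivative_transform_within_open[of _ _ _ ?U]) (use \<epsilon>(1) split in auto)
  moreover have "integral {0..1} (\<lambda>t. differential A f (\<gamma> t) (bump_field c \<gamma> a b u t)) = integral {a..b} (?d 0)"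
  proof -
    have "integral {0..1} (\<lambda>t. differential A f (\<gamma> t) (bump_field c \<gamma> a b u t))
       = integral {a..b} (\<lambda>t. bump a b t * differential A f (\<gamma> t) (coord_vec A c (\<gamma> t) u))"
      by (rule integral_bump_field[OF \<gamma> c ab]) (simp_all add: differential_tscale f)
    also have "\<dots> = integral {a..b} (?d 0)"
      by (rule integral_cong)
        (simp add: differential_in_chart[OF f c] ab c coord_vec_in_tangent_space coord_vec_same)
    finally show ?thesis .
  qed
  ultimately show ?thesis by simp
qed

section \<open>The differential on the path space\<close>

text \<open>Each rule that generates \<open>has_path_diff\<close> is a differentiation rule along a curve of paths. It is
  therefore enough that \<open>w\<close> is the velocity of the curve \<open>\<alpha>\<close> in the weak sense tested by the induced
  functions.\<close>
lemma has_path_diff_derivative: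
  assumes "has_path_diff A \<phi> D" "\<And>s. \<alpha> s \<in> path_space A" "\<alpha> 0 = \<gamma>"
    and "\<And>f. f \<in> C_inf A \<Longrightarrow> ((\<lambda>s. integral {0..1} (\<lambda>t. f (\<alpha> s t))) has_real_derivative
      integral {0..1} (\<lambda>t. differential A f (\<gamma> t) (w t))) (at 0)"
  shows "((\<lambda>s. \<phi> (\<alpha> s)) has_real_derivative D \<gamma> w) (at 0)"
  using assms(1)
proof induction
  case (induced f)
  then show ?case using assms(2,4) by (simp add: induced_def)
next
  case (scale \<phi> D r)
  then show ?case using DERIV_cmult[OF scale.IH, of r] assms(2) by simp
next
  case (add \<phi> D \<psi> E)
  then show ?case using DERIV_add[OF add.IH] assms(2) by simp
next
  case (leibniz \<phi> D \<psi> E)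
  then show ?case using DERIV_mult[OF leibniz.IH] assms(2,3) by (simp add: ac_simps)
qed

text \<open>At a fixed path the Leibniz rule has constant coefficients, so that the differential is the one of
  a single induced function. The function \<open>h\<close> depends on \<open>\<gamma>\<close>.\<close>
lemma has_path_diff_normal_form:
  assumes "has_path_diff A \<phi> D" and \<gamma>: "\<gamma> \<in> path_space A"
  shows "\<exists>h\<in>C_inf A. \<forall>w\<in>path_tangent_space A \<gamma>. D \<gamma> w = integral {0..1} (\<lambda>t. differential A h (\<gamma> t) (w t))"
proof -
  have SCALE: "r * integral {0..1} (\<lambda>t. differential A h (\<gamma> t) (w t))
      = integral {0..1} (\<lambda>t. differential A (\<lambda>p. r * h p) (\<gamma> t) (w t))"
    if "h \<in> C_inf A" "w \<in> path_tangent_space A \<gamma>" for r h w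
  proof -
    have "integral {0..1} (\<lambda>t. differential A (\<lambda>p. r * h p) (\<gamma> t) (w t))
      = integral {0..1} (\<lambda>t. r * differential A h (\<gamma> t) (w t))"
      by (rule integral_cong) (simp add: differential_scale that path_tangentD[OF that(2)])
    then show ?thesis by simp
  qed
  have ADD: "integral {0..1} (\<lambda>t. differential A h (\<gamma> t) (w t)) + integral {0..1} (\<lambda>t. differential A k (\<gamma> t) (w t))
      = integral {0..1} (\<lambda>t. differential A (\<lambda>p. h p + k p) (\<gamma> t) (w t))"
    if "h \<in> C_inf A" "k \<in> C_inf A" "w \<in> path_tangent_space A \<gamma>" for h k w
    using that \<gamma>
    by (subst Henstock_Kurzweil_Integration.integral_add[symmetric])
      (auto intro!: integral_cong integrable_differential_path simp: differential_add path_tangentD)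
  show ?thesis
    using assms(1)
  proof induction
    case (induced f)
    then show ?case by blast
  next
    case (scale \<phi> D r)
    then obtain h where "h \<in> C_inf A"
      "\<And>w. w \<in> path_tangent_space A \<gamma> \<Longrightarrow> D \<gamma> w = integral {0..1} (\<lambda>t. differential A h (\<gamma> t) (w t))" by blast
    then show ?case
      by (intro bexI[of _ "\<lambda>p. r * h p"]) (auto simp: SCALE C_inf_scale)
  next
    case (add \<phi> D \<psi> E)
    then obtain h k where "h \<in> C_inf A" "k \<in> C_inf A"
      "\<And>w. w \<in> path_tangent_space A \<gamma> \<Longrightarrow> D \<gamma> w = integral {0..1} (\<lambda>t. differential A h (\<gamma> t) (w t))"
      "\<And>w. w \<in> path_tangent_space A \<gamma> \<Longrightarrow> E \<gamma> w = integral {0..1} (\<lambda>t. differential A k (\<gamma> t) (w t))" by blast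
    then show ?case
      by (intro bexI[of _ "\<lambda>p. h p + k p"]) (auto simp: ADD C_inf_add)
  next
    case (leibniz \<phi> D \<psi> E)
    then obtain h k where "h \<in> C_inf A" "k \<in> C_inf A"
      "\<And>w. w \<in> path_tangent_space A \<gamma> \<Longrightarrow> D \<gamma> w = integral {0..1} (\<lambda>t. differential A h (\<gamma> t) (w t))"
      "\<And>w. w \<in> path_tangent_space A \<gamma> \<Longrightarrow> E \<gamma> w = integral {0..1} (\<lambda>t. differential A k (\<gamma> t) (w t))" by blast
    then show ?case
      by (intro bexI[of _ "\<lambda>p. \<phi> \<gamma> * k p + \<psi> \<gamma> * h p"]) (auto simp: ADD SCALE C_inf_add C_inf_scale)
  qed
qed

text \<open>Bump fields are velocities of curves of paths, so that the two differentials agree on them; by the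
  normal form the difference is a covector field integrated along \<open>\<gamma>\<close>, which must then vanish.\<close>
lemma has_path_diff_unique:
  assumes D: "has_path_diff A \<phi> D" and E: "has_path_diff A \<phi> E"
    and \<gamma>: "\<gamma> \<in> path_space A" and w: "w \<in> path_tangent_space A \<gamma>"
  shows "D \<gamma> w = E \<gamma> w"
proof -
  obtain h where h: "h \<in> C_inf A"
    "\<And>w. w \<in> path_tangent_space A \<gamma> \<Longrightarrow> D \<gamma> w = integral {0..1} (\<lambda>t. differential A h (\<gamma> t) (w t))"
    using has_path_diff_normal_form[OF D \<gamma>] by blast
  obtain k where k: "k \<in> C_inf A"
    "\<And>w. w \<in> path_tangent_space A \<gamma> \<Longrightarrow> E \<gamma> w = integral {0..1} (\<lambda>t. differential A k (\<gamma> t) (w t))"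
    using has_path_diff_normal_form[OF E \<gamma>] by blast
  have eq: "D \<gamma> (bump_field c \<gamma> a b u) = E \<gamma> (bump_field c \<gamma> a b u)"
    if c: "c \<in> A" and ab: "0 \<le> a" "b \<le> 1" "\<And>t. t \<in> {a..b} \<Longrightarrow> \<gamma> t \<in> chart_dom c" for c a b u
  proof -
    obtain \<epsilon> where \<epsilon>: "\<epsilon> > 0"
      "\<And>s t. \<bar>s\<bar> < \<epsilon> \<Longrightarrow> t \<in> {a..b} \<Longrightarrow> chart_map c (\<gamma> t) + (s * bump a b t) *\<^sub>R u \<in> chart_img c"
      using bump_variation_stays_in_chart[OF \<gamma> c ab] by metis
    \<comment> \<open>the variation may leave the chart for large \<open>s\<close>; a total curve of paths is obtained by resetting it to \<open>\<gamma>\<close> there\<close>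
    define \<alpha> where "\<alpha> s = (if \<bar>s\<bar> < \<epsilon> then bump_variation c \<gamma> a b u s else \<gamma>)" for s
    have \<alpha>: "\<alpha> s \<in> path_space A" for s
      using bump_variation_in_path_space[OF \<gamma> c ab(3) \<epsilon>(2)] \<gamma> by (simp add: \<alpha>_def)
    have \<alpha>0: "\<alpha> 0 = \<gamma>" using bump_variation_zero[OF \<gamma> c ab(3)] by (simp add: \<alpha>_def)
    have "((\<lambda>s. integral {0..1} (\<lambda>t. f (\<alpha> s t))) has_real_derivative
      integral {0..1} (\<lambda>t. differential A f (\<gamma> t) (bump_field c \<gamma> a b u t))) (at 0)"
      if f: "f \<in> C_inf A" for f
      by (rule has_field_derivative_transform_within_open[OF induced_bump_variation_derivative[OF \<gamma> c ab \<epsilon> f], of "{-\<epsilon><..<\<epsilon>}"])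
        (use \<epsilon>(1) in \<open>auto simp: \<alpha>_def abs_less_iff\<close>)
    note d = has_path_diff_derivative[OF _ \<alpha> \<alpha>0 this]
    show ?thesis by (rule DERIV_unique[OF d[OF D] d[OF E]])
  qed
  have "differential A h (\<gamma> t) v - differential A k (\<gamma> t) v = 0"
    if "t \<in> {0..1}" "v \<in> tangent_space A (\<gamma> t)" for t v
  proof (rule covector_along_path_zero[OF \<gamma>, where \<theta> = "\<lambda>t v. differential A h (\<gamma> t) v - differential A k (\<gamma> t) v"])
    fix c u assume c: "c \<in> A"
    have "smooth_into A {t \<in> {0..1}. \<gamma> t \<in> chart_dom c} \<gamma>"
      by (rule smooth_into_subset[OF path_smooth_into[OF \<gamma>]]) auto
    then show "continuous_on {t \<in> {0..1}. \<gamma> t \<in> chart_dom c}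
        (\<lambda>t. differential A h (\<gamma> t) (coord_vec A c (\<gamma> t) u) - differential A k (\<gamma> t) (coord_vec A c (\<gamma> t) u))"
      by (intro continuous_on_diff smooth_on_imp_continuous_on smooth_on_differential h k smooth_along_coord_vec c)
        (auto simp: c coord_vec_in_tangent_space)
  next
    fix c a b u assume c: "c \<in> A" and ab: "0 \<le> a" "a < b" "b \<le> 1" "\<And>t. t \<in> {a..b} \<Longrightarrow> \<gamma> t \<in> chart_dom c"
    have w: "bump_field c \<gamma> a b u \<in> path_tangent_space A \<gamma>"
      by (rule bump_field_in_path_tangent_space[OF \<gamma> c ab(4)])
    show "integral {0..1} (\<lambda>t. differential A h (\<gamma> t) (bump_field c \<gamma> a b u t)
        - differential A k (\<gamma> t) (bump_field c \<gamma> a b u t)) = 0"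
      using eq[OF c ab(1,3,4)] h(1) k(1) w \<gamma>
      by (simp add: Henstock_Kurzweil_Integration.integral_diff integrable_differential_path flip: h(2)[OF w] k(2)[OF w])
  qed (use that h k in \<open>auto simp: differential_tscale algebra_simps\<close>)
  then have "integral {0..1} (\<lambda>t. differential A h (\<gamma> t) (w t)) = integral {0..1} (\<lambda>t. differential A k (\<gamma> t) (w t))"
    using w by (intro integral_cong) (simp add: path_tangentD)
  then show ?thesis using h(2)[OF w] k(2)[OF w] by simp
qed

lemma path_diff_eq:
  assumes "has_path_diff A \<phi> D" "\<gamma> \<in> path_space A" "w \<in> path_tangent_space A \<gamma>"
  shows "path_diff A \<phi> \<gamma> w = D \<gamma> w"
  unfolding path_diff_def
  by (rule the_equality) (use assms has_path_diff_unique in blast)+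

text \<open>The base case uses that the constant 1 on the path space is induced by the constant 1. For
  \<open>n = 0\<close> the factor \<open>real n\<close> hides the truncated exponent \<open>n - 1\<close>.\<close>
lemma has_path_diff_power:
  assumes f: "f \<in> C_inf A"
  shows "\<exists>D. has_path_diff A (\<lambda>\<gamma>\<in>path_space A. induced A f \<gamma> ^ n) D \<and>
    (\<forall>\<gamma>\<in>path_space A. \<forall>w. D \<gamma> w =
      real n * induced A f \<gamma> ^ (n - 1) * integral {0..1} (\<lambda>t. differential A f (\<gamma> t) (w t)))"
proof (induction n)
  case 0
  have one: "induced A (\<lambda>p. 1) = (\<lambda>\<gamma>\<in>path_space A. induced A f \<gamma> ^ 0)" by (simp add: induced_def)
  have "has_path_diff A (\<lambda>\<gamma>\<in>path_space A. induced A f \<gamma> ^ 0)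
      (\<lambda>\<gamma> w. integral {0..1} (\<lambda>t. differential A (\<lambda>p. 1) (\<gamma> t) (w t)))"
    using has_path_diff.induced[OF C_inf_const[of 1]] unfolding one .
  then show ?case by (intro exI conjI) (assumption, simp add: differential_const)
next
  case (Suc n)
  then obtain D where D: "has_path_diff A (\<lambda>\<gamma>\<in>path_space A. induced A f \<gamma> ^ n) D"
    "\<And>\<gamma> w. \<gamma> \<in> path_space A \<Longrightarrow> D \<gamma> w =
      real n * induced A f \<gamma> ^ (n - 1) * integral {0..1} (\<lambda>t. differential A f (\<gamma> t) (w t))" by blast
  have "(\<lambda>\<gamma>\<in>path_space A. induced A f \<gamma> * (\<lambda>\<gamma>\<in>path_space A. induced A f \<gamma> ^ n) \<gamma>)
     = (\<lambda>\<gamma>\<in>path_space A. induced A f \<gamma> ^ Suc n)" by (auto simp: restrict_def fun_eq_iff)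
  with has_path_diff.leibniz[OF has_path_diff.induced[OF f] D(1)]
  have "has_path_diff A (\<lambda>\<gamma>\<in>path_space A. induced A f \<gamma> ^ Suc n)
      (\<lambda>\<gamma> w. induced A f \<gamma> * D \<gamma> w + (\<lambda>\<gamma>\<in>path_space A. induced A f \<gamma> ^ n) \<gamma> *
        integral {0..1} (\<lambda>t. differential A f (\<gamma> t) (w t)))" by simp
  then show ?case
    by (intro exI conjI) (assumption, cases n, auto simp: D(2) algebra_simps)
qed

lemma has_path_diff_power_comb:
  assumes "\<forall>i<k. F i \<in> C_inf A"
  shows "\<exists>D. has_path_diff A (power_comb A k a F n) D \<and>
    (\<forall>\<gamma>\<in>path_space A. \<forall>w. D \<gamma> w = (\<Sum>i<k. a i * real (n i) * induced A (F i) \<gamma> ^ (n i - 1) *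
      integral {0..1} (\<lambda>t. differential A (F i) (\<gamma> t) (w t))))"
  using assms
proof (induction k)
  case 0
  have "power_comb A 0 a F n = (\<lambda>\<gamma>\<in>path_space A. 0 * induced A (\<lambda>p. 0) \<gamma>)" by (simp add: power_comb_def)
  then have "has_path_diff A (power_comb A 0 a F n) (\<lambda>\<gamma> w. 0 * integral {0..1} (\<lambda>t. differential A (\<lambda>p. 0) (\<gamma> t) (w t)))"
    using has_path_diff.scale[OF has_path_diff.induced[OF C_inf_const[of 0]], of 0] by simp
  then show ?case by (intro exI conjI) (assumption, simp)
next
  case (Suc k)
  then obtain D where D: "has_path_diff A (power_comb A k a F n) D"
    "\<And>\<gamma> w. \<gamma> \<in> path_space A \<Longrightarrow> D \<gamma> w = (\<Sum>i<k. a i * real (n i) * induced A (F i) \<gamma> ^ (n i - 1) *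
      integral {0..1} (\<lambda>t. differential A (F i) (\<gamma> t) (w t)))" by auto
  obtain E where E: "has_path_diff A (\<lambda>\<gamma>\<in>path_space A. induced A (F k) \<gamma> ^ n k) E"
    "\<And>\<gamma> w. \<gamma> \<in> path_space A \<Longrightarrow> E \<gamma> w = real (n k) * induced A (F k) \<gamma> ^ (n k - 1) *
      integral {0..1} (\<lambda>t. differential A (F k) (\<gamma> t) (w t))"
    using has_path_diff_power[of "F k" "n k"] Suc.prems by auto
  have "(\<lambda>\<gamma>\<in>path_space A. power_comb A k a F n \<gamma> +
      (\<lambda>\<gamma>\<in>path_space A. a k * (\<lambda>\<gamma>\<in>path_space A. induced A (F k) \<gamma> ^ n k) \<gamma>) \<gamma>) = power_comb A (Suc k) a F n"
    by (auto simp: power_comb_def restrict_def fun_eq_iff)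
  then have "has_path_diff A (power_comb A (Suc k) a F n) (\<lambda>\<gamma> w. D \<gamma> w + a k * E \<gamma> w)"
    using has_path_diff.add[OF D(1) has_path_diff.scale[OF E(1), of "a k"]] by simp
  then show ?case using D(2) E(2) by (intro exI conjI) (assumption, auto)
qed

lemma induced_add:
  assumes "f \<in> C_inf A" "g \<in> C_inf A" "\<gamma> \<in> path_space A"
  shows "induced A (\<lambda>p. f p + g p) \<gamma> = induced A f \<gamma> + induced A g \<gamma>"
  using assms by (simp add: induced_def integrable_C_inf_path Henstock_Kurzweil_Integration.integral_add)

lemma smooth_on_induced_plot:
  assumes \<alpha>: "plot A U \<alpha>" and f: "f \<in> C_inf A"
  shows "smooth_on U (\<lambda>u. induced A f (\<alpha> u))"
proof -
  have "smooth_on (U \<times> {0..1}) (\<lambda>(u, t). f (\<alpha> u t))"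
    using smooth_on_C_inf_compose[OF f, of "U \<times> {0..1}" "\<lambda>(u, t). \<alpha> u t"] \<alpha>
    by (simp add: plot_def case_prod_unfold)
  from smooth_on_integral[OF _ this]
  have "smooth_on U (\<lambda>u. integral {0..1} (\<lambda>t. f (\<alpha> u t)))" by simp
  then show ?thesis by (rule smooth_on_cong) (use \<alpha> in \<open>simp add: plot_def induced_def\<close>)
qed

end

section \<open>Hamiltonian vector fields on the path space\<close>

context almost_symplectic
begin

text \<open>The difference of \<open>v\<close> and \<open>v'\<close>, contracted with \<open>\<omega>\<close>, is a covector field along \<open>\<gamma>\<close> with
  vanishing integrals, hence zero; then \<open>\<omega>\<close> is nondegenerate at each \<open>\<gamma> t\<close>.\<close>
lemma path_form_nondegenerate:
  assumes \<gamma>: "\<gamma> \<in> path_space A"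
    and v: "v \<in> path_tangent_space A \<gamma>" and v': "v' \<in> path_tangent_space A \<gamma>"
    and eq: "\<And>w. w \<in> path_tangent_space A \<gamma> \<Longrightarrow> path_form \<omega> \<gamma> v w = path_form \<omega> \<gamma> v' w"
  shows "v = v'"
proof -
  let ?\<theta> = "\<lambda>t w. \<omega> (\<gamma> t) (v t) w - \<omega> (\<gamma> t) (v' t) w"
  note T = path_tangentD(1)[OF v] path_tangentD(1)[OF v']
  have "?\<theta> t w = 0" if "t \<in> {0..1}" "w \<in> tangent_space A (\<gamma> t)" for t w
  proof (rule covector_along_path_zero[OF \<gamma>, where \<theta> = ?\<theta>])
    fix c u assume c: "c \<in> A"
    let ?S = "{t \<in> {0..1}. \<gamma> t \<in> chart_dom c}"
    have h: "smooth_into A ?S \<gamma>" by (rule smooth_into_subset[OF path_smooth_into[OF \<gamma>]]) auto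
    have V: "smooth_along A ?S \<gamma> v" "smooth_along A ?S \<gamma> v'"
      by (rule smooth_along_subset[OF path_tangentD(2)[OF v]] smooth_along_subset[OF path_tangentD(2)[OF v']]; auto)+
    show "continuous_on ?S (\<lambda>t. ?\<theta> t (coord_vec A c (\<gamma> t) u))"
      by (intro continuous_on_diff smooth_on_imp_continuous_on smooth_on_form h V smooth_along_coord_vec c)
        (auto simp: c coord_vec_in_tangent_space T)
  next
    fix c a b u assume c: "c \<in> A" and ab: "0 \<le> a" "a < b" "b \<le> 1" "\<And>t. t \<in> {a..b} \<Longrightarrow> \<gamma> t \<in> chart_dom c"
    have w: "bump_field c \<gamma> a b u \<in> path_tangent_space A \<gamma>"
      by (rule bump_field_in_path_tangent_space[OF \<gamma> c ab(4)])
    have "(\<lambda>t. \<omega> (\<gamma> t) (x t) (bump_field c \<gamma> a b u t)) integrable_on {0..1}" if "x \<in> path_tangent_space A \<gamma>" for x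
      by (intro integrable_continuous_interval smooth_on_imp_continuous_on smooth_on_form
          path_smooth_into \<gamma> path_tangentD that w path_tangentD(1)[OF that])
    then show "integral {0..1} (\<lambda>t. ?\<theta> t (bump_field c \<gamma> a b u t)) = 0"
      using eq[OF w] v v' by (simp add: path_form_def Henstock_Kurzweil_Integration.integral_diff)
  qed (use that T in \<open>auto simp: form_scale_right algebra_simps\<close>)
  then have "v t = v' t" if "t \<in> {0..1}" for t
    using that by (intro form_eqI[OF T]) auto
  moreover have "v \<in> (\<Pi>\<^sub>E t\<in>{0..1}. tangent_space A (\<gamma> t))" "v' \<in> (\<Pi>\<^sub>E t\<in>{0..1}. tangent_space A (\<gamma> t))"
    using v v' unfolding path_tangent_space_def by blast+
  ultimately show ?thesis by (metis PiE_ext)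
qed

lemma path_hamiltonian_vf_unique:
  assumes "is_path_hamiltonian_vf TYPE('d::euclidean_space) A \<omega> \<phi> X"
    "is_path_hamiltonian_vf TYPE('d) A \<omega> \<phi> Y"
  shows "X = Y"
proof -
  have XY: "X \<in> (\<Pi>\<^sub>E \<gamma>\<in>path_space A. path_tangent_space A \<gamma>)" "Y \<in> (\<Pi>\<^sub>E \<gamma>\<in>path_space A. path_tangent_space A \<gamma>)"
    using assms by (auto simp: is_path_hamiltonian_vf_def path_vector_fields_def)
  show ?thesis
  proof (rule PiE_ext[OF XY])
    fix \<gamma> assume "\<gamma> \<in> path_space A"
    then show "X \<gamma> = Y \<gamma>"
      using assms XY by (intro path_form_nondegenerate) (auto simp: is_path_hamiltonian_vf_def)
  qed
qed

definition power_comb_field ::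
  "nat \<Rightarrow> (nat \<Rightarrow> real) \<Rightarrow> (nat \<Rightarrow> 'a \<Rightarrow> real) \<Rightarrow> (nat \<Rightarrow> nat) \<Rightarrow> 'a path \<Rightarrow> ('a, 'e) path_tvec" where
  "power_comb_field k a F n = (\<lambda>\<gamma>\<in>path_space A. \<lambda>t\<in>{0..1}.
     tsum (\<lambda>i. tscale (a i * real (n i) * induced A (F i) \<gamma> ^ (n i - 1)) (hamiltonian_vf A \<omega> (F i) (\<gamma> t))) {..<k})"

text \<open>Along a plot the coefficients depend smoothly on the parameter, being polynomials in integrals of
  smooth functions, and the fields \<open>X\<^bsub>F i\<^esub>\<close> are composed with the smooth map \<open>(u, t) \<mapsto> \<alpha> u t\<close>.\<close>
lemma power_comb_field_in_path_vector_fields: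
  assumes F: "\<forall>i<k. F i \<in> C_inf A"
  shows "power_comb_field k a F n \<in> path_vector_fields TYPE('d::euclidean_space) A"
proof -
  let ?X = "power_comb_field k a F n"
  have "?X \<gamma> \<in> path_tangent_space A \<gamma>" if \<gamma>: "\<gamma> \<in> path_space A" for \<gamma>
    unfolding path_tangent_space_def
  proof (intro CollectI conjI)
    show "?X \<gamma> \<in> (\<Pi>\<^sub>E t\<in>{0..1}. tangent_space A (\<gamma> t))"
      using F \<gamma> by (intro PiE_I)
        (auto simp: power_comb_field_def hamiltonian_vf_props intro!: tangent_space_tsum tangent_space_tscale)
    have "smooth_along A {0..1} \<gamma> (\<lambda>t. tsum (\<lambda>i. tscale (a i * real (n i) * induced A (F i) \<gamma> ^ (n i - 1))
        (hamiltonian_vf A \<omega> (F i) (\<gamma> t))) {..<k})"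
      by (intro smooth_along_tsum smooth_along_tscale smooth_on_const smooth_along_vector_field path_smooth_into \<gamma>)
        (use F in \<open>auto simp: hamiltonian_vf_props\<close>)
    then show "smooth_along A {0..1} \<gamma> (?X \<gamma>)"
      by (rule smooth_along_cong) (simp add: power_comb_field_def \<gamma>)
  qed
  moreover have "smooth_along A (U \<times> {0..1}) (\<lambda>(u, t). \<alpha> u t) (\<lambda>(u, t). ?X (\<alpha> u) t)"
    if \<alpha>: "plot A U \<alpha>" for U :: "'d set" and \<alpha>
  proof -
    have h: "smooth_into A (U \<times> {0..1}) (\<lambda>x. \<alpha> (fst x) (snd x))"
      using \<alpha> by (simp add: plot_def case_prod_unfold)
    have "smooth_on (U \<times> {0..1}) (\<lambda>x. induced A (F i) (\<alpha> (fst x)))" if "i < k" for i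
      by (rule smooth_on_compose[OF smooth_on_linear_map[OF bounded_linear_fst] smooth_on_induced_plot[OF \<alpha>]])
        (use F that in auto)
    then have "smooth_along A (U \<times> {0..1}) (\<lambda>x. \<alpha> (fst x) (snd x))
       (\<lambda>x. tsum (\<lambda>i. tscale (a i * real (n i) * induced A (F i) (\<alpha> (fst x)) ^ (n i - 1))
        (hamiltonian_vf A \<omega> (F i) (\<alpha> (fst x) (snd x)))) {..<k})"
      by (intro smooth_along_tsum smooth_along_tscale smooth_on_mult smooth_on_power smooth_on_const
          smooth_along_vector_field[OF _ h])
        (use F in \<open>auto simp: hamiltonian_vf_props\<close>)
    then show ?thesis
      unfolding case_prod_beta
      by (rule smooth_along_cong) (use \<alpha> in \<open>auto simp: power_comb_field_def plot_def\<close>)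
  qed
  ultimately show ?thesis
    unfolding path_vector_fields_def by (auto simp: power_comb_field_def)
qed

text \<open>The coefficients do not depend on \<open>t\<close>, so that the equations \<open>\<omega>(X\<^bsub>F i\<^esub>, w) = - dF\<^sub>i(w)\<close> may be
  combined under the integral and integrated term by term.\<close>
lemma power_comb_field_hamiltonian:
  assumes F: "\<forall>i<k. F i \<in> C_inf A"
  shows "is_path_hamiltonian_vf TYPE('d::euclidean_space) A \<omega> (power_comb A k a F n) (power_comb_field k a F n)"
  unfolding is_path_hamiltonian_vf_def
proof (intro conjI ballI power_comb_field_in_path_vector_fields F)
  fix \<gamma> w assume \<gamma>: "\<gamma> \<in> path_space A" and w: "w \<in> path_tangent_space A \<gamma>"
  let ?c = "\<lambda>i. a i * real (n i) * induced A (F i) \<gamma> ^ (n i - 1)"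
  obtain D where D: "has_path_diff A (power_comb A k a F n) D"
    "\<And>\<gamma> w. \<gamma> \<in> path_space A \<Longrightarrow> D \<gamma> w = (\<Sum>i<k. a i * real (n i) * induced A (F i) \<gamma> ^ (n i - 1) *
      integral {0..1} (\<lambda>t. differential A (F i) (\<gamma> t) (w t)))"
    using has_path_diff_power_comb[OF F] by blast
  have "path_form \<omega> \<gamma> (power_comb_field k a F n \<gamma>) w
    = integral {0..1} (\<lambda>t. \<Sum>i<k. - (?c i * differential A (F i) (\<gamma> t) (w t)))"
    unfolding path_form_def
  proof (rule integral_cong)
    fix t :: real assume t: "t \<in> {0..1}"
    have "\<omega> (\<gamma> t) (power_comb_field k a F n \<gamma> t) (w t)
      = (\<Sum>i<k. \<omega> (\<gamma> t) (tscale (?c i) (hamiltonian_vf A \<omega> (F i) (\<gamma> t))) (w t))"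
      using t \<gamma> F by (simp add: power_comb_field_def form_tsum_left path_tangentD[OF w] tangent_space_tscale hamiltonian_vf_props)
    also have "\<dots> = (\<Sum>i<k. - (?c i * differential A (F i) (\<gamma> t) (w t)))"
      using t F by (intro sum.cong) (auto simp: form_scale_left path_tangentD[OF w] hamiltonian_vf_props)
    finally show "\<omega> (\<gamma> t) (power_comb_field k a F n \<gamma> t) (w t)
      = (\<Sum>i<k. - (?c i * differential A (F i) (\<gamma> t) (w t)))" .
  qed
  also have "\<dots> = (\<Sum>i<k. integral {0..1} (\<lambda>t. - (?c i * differential A (F i) (\<gamma> t) (w t))))"
    using F by (intro integral_sum) (auto intro!: integrable_neg integrable_on_mult_right integrable_differential_path[OF _ \<gamma> w])
  also have "\<dots> = - D \<gamma> w" using D(2)[OF \<gamma>] by (simp add: sum_negf)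
  also have "D \<gamma> w = path_diff A (power_comb A k a F n) \<gamma> w" using path_diff_eq[OF D(1) \<gamma> w] by simp
  finally show "path_form \<omega> \<gamma> (power_comb_field k a F n \<gamma>) w = - path_diff A (power_comb A k a F n) \<gamma> w" .
qed

lemma path_hamiltonian_vf_power_comb:
  assumes F: "\<forall>i<k. F i \<in> C_inf A"
  shows "\<exists>!X. is_path_hamiltonian_vf TYPE('d::euclidean_space) A \<omega> (power_comb A k a F n) X"
    and "path_hamiltonian_vf TYPE('d) A \<omega> (power_comb A k a F n) = power_comb_field k a F n"
proof -
  note H = power_comb_field_hamiltonian[OF F, where 'd = 'd, of a n]
  show "\<exists>!X. is_path_hamiltonian_vf TYPE('d) A \<omega> (power_comb A k a F n) X"
    using H path_hamiltonian_vf_unique by blast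
  show "path_hamiltonian_vf TYPE('d) A \<omega> (power_comb A k a F n) = power_comb_field k a F n"
    unfolding path_hamiltonian_vf_def using H path_hamiltonian_vf_unique by (blast intro: the_equality)
qed

text \<open>Elements of \<open>Omega0 A\<close> are combinations of powers, not of products. The product is written as
  half of \<open>(x + y)\<^sup>2 - x\<^sup>2 - y\<^sup>2\<close> with \<open>x + y\<close> induced by \<open>f + g\<close>; its field then has the coefficient
  \<open>(x + y) - x = y\<close> at \<open>X\<^sub>f\<close>, and \<open>x\<close> at \<open>X\<^sub>g\<close>.\<close>
lemma induced_product_polarization:
  assumes f: "f \<in> C_inf A" and g: "g \<in> C_inf A"
  shows "\<exists>F a. (\<forall>i<3. F i \<in> C_inf A) \<and>
    (\<lambda>\<gamma>\<in>path_space A. induced A f \<gamma> * induced A g \<gamma>) = power_comb A 3 a F (\<lambda>_. 2) \<and>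
    (\<forall>\<gamma>\<in>path_space A. \<forall>t\<in>{0..1}. power_comb_field 3 a F (\<lambda>_. 2) \<gamma> t =
      tadd (tscale (induced A g \<gamma>) (hamiltonian_vf A \<omega> f (\<gamma> t)))
        (tscale (induced A f \<gamma>) (hamiltonian_vf A \<omega> g (\<gamma> t))))"
proof -
  define F where "F = (\<lambda>i::nat. if i = 0 then (\<lambda>p. f p + g p) else if i = 1 then f else g)"
  define a :: "nat \<Rightarrow> real" where "a = (\<lambda>i. if i = 0 then 1 / 2 else - 1 / 2)"
  have three: "{..<3::nat} = {0, 1, 2}" by auto
  show ?thesis
  proof (intro exI[of _ F] exI[of _ a] conjI ballI)
    show "(\<lambda>\<gamma>\<in>path_space A. induced A f \<gamma> * induced A g \<gamma>) = power_comb A 3 a F (\<lambda>_. 2)"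
      unfolding power_comb_def
      by (rule restrict_ext) (simp add: three F_def a_def induced_add f g power2_eq_square algebra_simps)
    show "\<forall>i<3. F i \<in> C_inf A" by (simp add: F_def f g C_inf_add)
    show "power_comb_field 3 a F (\<lambda>_. 2) \<gamma> t =
        tadd (tscale (induced A g \<gamma>) (hamiltonian_vf A \<omega> f (\<gamma> t)))
          (tscale (induced A f \<gamma>) (hamiltonian_vf A \<omega> g (\<gamma> t)))"
      if "\<gamma> \<in> path_space A" "t \<in> {0..1}" for \<gamma> t
      using that
      by (simp add: power_comb_field_def three F_def a_def tsum_def tadd_def tscale_def induced_add f g
          hamiltonian_vf_add algebra_simps fun_eq_iff)
  qed
qed

end

theorem corollary2p3:
  fixes A :: "('a::{t2_space,second_countable_topology}, 'e::euclidean_space) chart set"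
    and \<omega> :: "('a, 'e) form2"
    and f g :: "'a \<Rightarrow> real"
    and \<zeta> :: "'a path \<Rightarrow> real"
  assumes "symplectic_manifold A \<omega>"
    and "compact (UNIV :: 'a set)"
    and "connected (UNIV :: 'a set)"
    and "f \<in> C_inf A"
    and "g \<in> C_inf A"
    and "\<zeta> = (\<lambda>\<gamma>\<in>path_space A. induced A f \<gamma> * induced A g \<gamma>)"
  shows "(\<forall>k a F n. (\<forall>i<k. F i \<in> C_inf A) \<longrightarrow>
            (\<exists>!X. is_path_hamiltonian_vf TYPE('d::euclidean_space) A \<omega> (power_comb A k a F n) X) \<and>
            (\<forall>\<gamma>\<in>path_space A. \<forall>t\<in>{0..1}.
               path_hamiltonian_vf TYPE('d) A \<omega> (power_comb A k a F n) \<gamma> t =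
               tsum (\<lambda>i. tscale (a i * real (n i) * induced A (F i) \<gamma> ^ (n i - 1))
                           (hamiltonian_vf A \<omega> (F i) (\<gamma> t))) {..<k}))
    \<and> \<zeta> \<in> Omega0 A
    \<and> (\<exists>!X. is_path_hamiltonian_vf TYPE('d) A \<omega> \<zeta> X)
    \<and> (\<forall>\<gamma>\<in>path_space A. \<forall>t\<in>{0..1}.
         path_hamiltonian_vf TYPE('d) A \<omega> \<zeta> \<gamma> t =
         tadd (tscale (integral {0..1} (\<lambda>s. g (\<gamma> s))) (hamiltonian_vf A \<omega> f (\<gamma> t)))
              (tscale (integral {0..1} (\<lambda>s. f (\<gamma> s))) (hamiltonian_vf A \<omega> g (\<gamma> t))))"
proof -
  interpret almost_symplectic A \<omega>
    using assms(1) by unfold_locales (auto simp: symplectic_manifold_def)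
  obtain F a where pol: "\<forall>i<3. F i \<in> C_inf A" "\<zeta> = power_comb A 3 a F (\<lambda>_. 2)"
    "\<forall>\<gamma>\<in>path_space A. \<forall>t\<in>{0..1}. power_comb_field 3 a F (\<lambda>_. 2) \<gamma> t =
      tadd (tscale (induced A g \<gamma>) (hamiltonian_vf A \<omega> f (\<gamma> t)))
        (tscale (induced A f \<gamma>) (hamiltonian_vf A \<omega> g (\<gamma> t)))"
    unfolding assms(6) using induced_product_polarization[OF assms(4,5)] by (elim exE conjE)
  note vf = path_hamiltonian_vf_power_comb[where 'd = 'd]
  show ?thesis
  proof (intro conjI)
    show "\<forall>k a F n. (\<forall>i<k. F i \<in> C_inf A) \<longrightarrow>
            (\<exists>!X. is_path_hamiltonian_vf TYPE('d) A \<omega> (power_comb A k a F n) X) \<and>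
            (\<forall>\<gamma>\<in>path_space A. \<forall>t\<in>{0..1}.
               path_hamiltonian_vf TYPE('d) A \<omega> (power_comb A k a F n) \<gamma> t =
               tsum (\<lambda>i. tscale (a i * real (n i) * induced A (F i) \<gamma> ^ (n i - 1))
                           (hamiltonian_vf A \<omega> (F i) (\<gamma> t))) {..<k})"
      by (intro allI impI conjI vf) (simp_all add: vf(2) power_comb_field_def)
    show "\<zeta> \<in> Omega0 A" unfolding Omega0_def using pol(1,2) by blast
    show "\<exists>!X. is_path_hamiltonian_vf TYPE('d) A \<omega> \<zeta> X"
      unfolding pol(2) by (rule vf(1)[OF pol(1)])
    show "\<forall>\<gamma>\<in>path_space A. \<forall>t\<in>{0..1}.
         path_hamiltonian_vf TYPE('d) A \<omega> \<zeta> \<gamma> t =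
         tadd (tscale (integral {0..1} (\<lambda>s. g (\<gamma> s))) (hamiltonian_vf A \<omega> f (\<gamma> t)))
              (tscale (integral {0..1} (\<lambda>s. f (\<gamma> s))) (hamiltonian_vf A \<omega> g (\<gamma> t)))"
      using pol(3) by (simp add: pol(2) vf(2)[OF pol(1)] induced_def)
  qed
qed

end
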